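(* Let $1<p<\infty$, $m\in\mathbb{N}$, and $n_i\in\mathbb{N}$ for $1\le i\le m$. For each $d\in\{n_1,\dots,n_m\}$ let $K^{(d)}$ be a nonnegative kernel on $\mathbb{R}^{d}\times\mathbb{R}^{d}$ which is continuous on any domain that excludes the point $(0,0)$, is homogeneous of degree $-d$, i.e. $K^{(d)}(\delta u,\delta v)=\delta^{-d}K^{(d)}(u,v)$ for $\delta>0$, and satisfies $K^{(d)}(Ru,Rv)=K^{(d)}(u,v)$ for every $R\in \mathrm{SO}(d)$. For $x=(x_1,\dots,x_m)$ with $x_i\in\mathbb{R}^{n_i}$, let $$T_m f(x)=\int_{\mathbb{R}^{n_1}}\cdots\int_{\mathbb{R}^{n_m}} K^{(n_1)}(x_1,y_1)\cdots K^{(n_m)}(x_m,y_m)\, f(y_1,\dots,y_m)\,dy_1\cdots dy_m .$$ Let $e_i=(1,0,\dots,0)\in\mathbb{R}^{n_i}$ and put $$C=\int_{\mathbb{R}^{n_1}}\cdots\int_{\mathbb{R}^{n_m}} K^{(n_1)}(e_1,y_1)\cdots K^{(n_m)}(e_m,y_m)\,|y_1|^{-\frac{n_1}{p}}\cdots|y_m|^{-\frac{n_m}{p}}\,dy_1\cdots dy_m .$$ If $f\in L^p(\mathbb{R}^{n_1}\times\cdots\times\mathbb{R}^{n_m})$, then $$\|T_m f\|_{L^p(\mathbb{R}^{n_1}\times\cdots\times\mathbb{R}^{n_m})}\le C\,\|f\|_{L^p(\mathbb{R}^{n_1}\times\cdots\times\mathbb{R}^{n_m})}.$$ Moreover, the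 operator norm satisfies $$\|T_m\|_{L^p(\mathbb{R}^{n_1}\times\cdots\times\mathbb{R}^{n_m})\to L^p(\mathbb{R}^{n_1}\times\cdots\times\mathbb{R}^{n_m})}=C .$$
   Context: All $L^p$ spaces on $\mathbb{R}^{n_1}\times\cdots\times\mathbb{R}^{n_m}$ are with respect to Lebesgue measure, and $|\cdot|$ is the Euclidean norm. $\mathrm{SO}(d)$ denotes the group of rotations of $\mathbb{R}^d$. The vector $e_i$ is the unit vector in the first coordinate direction of $\mathbb{R}^{n_i}$. The kernels are indexed by dimension: $K^{(d)}$ is the kernel used on $\mathbb{R}^d\times\mathbb{R}^d$.
   Formalization: If some n_i = 1, K^{(1)}(-u,-v)=K^{(1)}(u,v) is also assumed: SO(1) is trivial and the claim fails there, e.g. m=1, n_1=1, K(u,v)=(|u|-u)/(u^2+v^2) gives C=0 but T≠0. *)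

theory Defs
  imports "HOL-Analysis.Analysis" "Jordan_Normal_Form.Determinant"
begin

text \<open>
  Since the dimensions \<open>n 1, \<dots>, n m\<close> vary inside one statement, a point of $R^d$ is a function
  \<open>nat \<Rightarrow> real\<close> that is \<open>undefined\<close> outside \<open>{..<d}\<close>, and a point of the product space is a
  function on \<open>{1..m}\<close> whose \<open>i\<close>-th value is a point of $R^{n_i}$.  On \<open>Rn d\<close> the topology
  induced by the product topology of \<open>nat \<Rightarrow> real\<close> is the Euclidean one.
\<close>

definition Rn :: "nat \<Rightarrow> (nat \<Rightarrow> real) set" where
  "Rn d = PiE {..<d} (\<lambda>_. UNIV)"

definition origin :: "nat \<Rightarrow> nat \<Rightarrow> real" where
  "origin d = (\<lambda>j\<in>{..<d}. 0)"

definition first_unit :: "nat \<Rightarrow> nat \<Rightarrow> real" where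
  "first_unit d = (\<lambda>j\<in>{..<d}. if j = 0 then 1 else 0)"

definition dilate :: "nat \<Rightarrow> real \<Rightarrow> (nat \<Rightarrow> real) \<Rightarrow> nat \<Rightarrow> real" where
  "dilate d c u = (\<lambda>j\<in>{..<d}. c * u j)"

definition eucl_norm :: "nat \<Rightarrow> (nat \<Rightarrow> real) \<Rightarrow> real" where
  "eucl_norm d u = L2_set u {..<d}"

definition SO :: "nat \<Rightarrow> real mat set" where
  "SO d = {R \<in> carrier_mat d d. R * transpose_mat R = 1\<^sub>m d \<and> Determinant.det R = 1}"

definition mat_apply :: "nat \<Rightarrow> real mat \<Rightarrow> (nat \<Rightarrow> real) \<Rightarrow> nat \<Rightarrow> real" where
  "mat_apply d R u = (\<lambda>i\<in>{..<d}. \<Sum>j<d. R $$ (i, j) * u j)"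

text \<open>Completing the Borel product measure gives Lebesgue measure, as for \<open>lebesgue\<close>.\<close>

definition leb :: "nat \<Rightarrow> (nat \<Rightarrow> nat) \<Rightarrow> (nat \<Rightarrow> nat \<Rightarrow> real) measure" where
  "leb m n = completion (\<Pi>\<^sub>M i\<in>{1..m}. \<Pi>\<^sub>M j\<in>{..<n i}. lborel)"

text \<open>The value \<open>\<infinity>\<close> is allowed; the root is taken in the reals only when the integral is finite.\<close>

definition Lp_norm :: "real \<Rightarrow> 'a measure \<Rightarrow> ('a \<Rightarrow> 'b::real_normed_vector) \<Rightarrow> ennreal" where
  "Lp_norm p M f =
     (let I = (\<integral>\<^sup>+x. ennreal (norm (f x) powr p) \<partial>M)
      in if I = \<infinity> then \<infinity> else ennreal (enn2real I powr (1 / p)))"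

definition Lp :: "real \<Rightarrow> 'a measure \<Rightarrow> ('a \<Rightarrow> 'b::real_normed_vector) set" where
  "Lp p M = {f \<in> borel_measurable M. Lp_norm p M f < \<infinity>}"

definition Lp_opnorm ::
    "real \<Rightarrow> 'a measure \<Rightarrow> (('a \<Rightarrow> 'b::real_normed_vector) \<Rightarrow> 'a \<Rightarrow> 'b) \<Rightarrow> ennreal" where
  "Lp_opnorm p M T = (SUP f \<in> {f \<in> Lp p M. Lp_norm p M f \<le> 1}. Lp_norm p M (T f))"

definition prod_kernel ::
    "nat \<Rightarrow> (nat \<Rightarrow> nat) \<Rightarrow> (nat \<Rightarrow> (nat \<Rightarrow> real) \<Rightarrow> (nat \<Rightarrow> real) \<Rightarrow> real)
      \<Rightarrow> (nat \<Rightarrow> nat \<Rightarrow> real) \<Rightarrow> (nat \<Rightarrow> nat \<Rightarrow> real) \<Rightarrow> real" where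
  "prod_kernel m n K x y = (\<Prod>i\<in>{1..m}. K (n i) (x i) (y i))"

definition T_op ::
    "nat \<Rightarrow> (nat \<Rightarrow> nat) \<Rightarrow> (nat \<Rightarrow> (nat \<Rightarrow> real) \<Rightarrow> (nat \<Rightarrow> real) \<Rightarrow> real)
      \<Rightarrow> ((nat \<Rightarrow> nat \<Rightarrow> real) \<Rightarrow> 'b::{banach, second_countable_topology})
      \<Rightarrow> (nat \<Rightarrow> nat \<Rightarrow> real) \<Rightarrow> 'b" where
  "T_op m n K f x = (LINT y|leb m n. prod_kernel m n K x y *\<^sub>R f y)"

definition C_const ::
    "real \<Rightarrow> nat \<Rightarrow> (nat \<Rightarrow> nat) \<Rightarrow> (nat \<Rightarrow> (nat \<Rightarrow> real) \<Rightarrow> (nat \<Rightarrow> real) \<Rightarrow> real)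
      \<Rightarrow> ennreal" where
  "C_const p m n K =
     (\<integral>\<^sup>+y. ennreal (prod_kernel m n K (\<lambda>i\<in>{1..m}. first_unit (n i)) y *
                   (\<Prod>i\<in>{1..m}. eucl_norm (n i) (y i) powr (- (real (n i) / p)))) \<partial>leb m n)"

end

theory Submission
  imports Defs
begin

text \<open>
  Write $d$ for one of the dimensions, $e$ for the first unit vector, and $q$ for the exponent
  conjugate to $p$.  Everything rests on one computation for a single kernel.  For $x \neq 0$ and a
  radial weight $w$,
  $$\int K(x,y)\, w(|y|)\, dy = \int K(e,y)\, w(|x|\,|y|)\, dy ,$$
  because the left side is invariant under rotations of $x$ and dilations are compatible with the
  homogeneity of $K$ (\<open>nn_integral_kernel_radial\<close>).  For $w(r) = r^{-d/p}$ this says that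
  $|y|^{-d/p}$ is a generalised eigenfunction of the operator with kernel $K$, with eigenvalue
  $\kappa = \int K(e,y) |y|^{-d/p} dy$.  The eigenvalue is finite, since compactness of the unit sphere
  and homogeneity give $K(u,v) \le B (|u|^2 + |v|^2)^{-d/2}$.  By Tonelli the product of the
  eigenfunctions is an eigenfunction of the product kernel, with eigenvalue $C = \prod_i \kappa_i$.

  The transposed kernel satisfies the same hypotheses, so $|x|^{-d/q}$ is an eigenfunction of the
  adjoint.  Its eigenvalue is again $\kappa$ (\<open>moment_transpose\<close>): the function
  $K(x,y) |x|^{-d/q} |y|^{-d/p}$ on pairs is homogeneous of degree $-2d$, so its integral over the pairs
  with $x$ in the dyadic shell $0$ and $y$ in the shell $k$ equals the one over the pairs with $x$ in the
  shell $-k$ and $y$ in the shell $0$.  Summing over all $k$ gives $\kappa$ times the common mass of the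
  shells under $|x|^{-d} dx$ on one side, and the adjoint eigenvalue times the same mass on the other.

  With positive eigenfunctions of the operator and of its adjoint for the same eigenvalue $C$, the Schur
  test with weight $\prod_i |x_i|^{-n_i/(pq)}$ bounds the norm by $C$ (\<open>Schur_test\<close>).  For the lower
  bound, the operator is applied to the eigenfunction cut off to
  $2^{-L} \le |y_i| < 2^{N+L}$.  On $1 \le |x_i| < 2^N$ the image is at least
  $\prod_i \kappa_{L,i} |x_i|^{-n_i/p}$, where $\kappa_{L,i}$ is the integral for $\kappa_i$ restricted to
  $2^{-L} \le |y| < 2^L$.  In the $i$-th factor the integrals of $|y_i|^{-n_i}$ over the two regions
  are $N + 2L$ and $N$ shell masses; with $N = L^2$ their ratio tends to $1$, while $\kappa_{L,i}$ tends to $\kappa_i$.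

  Rotation invariance of the measure, in coordinates, comes from the fact that a plane rotation is a
  product of three shears, each of which preserves Lebesgue measure by Fubini.
\<close>

section \<open>Lebesgue measure on $R^d$ and dilations\<close>

text \<open>
  The exceptional set lies in a box with one null side, and a product with a factor $0$ vanishes even when
  the other sides have infinite measure.
\<close>

lemma (in product_sigma_finite) AE_PiM_component:
  assumes I: "finite I" "i \<in> I" and P: "AE x in M i. P x"
  shows "AE x in Pi\<^sub>M I M. P (x i)"
proof -
  obtain N where N: "N \<in> null_sets (M i)" "{x \<in> space (M i). \<not> P x} \<subseteq> N"
    using P by (auto elim!: AE_E)
  let ?N = "Pi\<^sub>E I (\<lambda>j. if j = i then N else space (M j))"
  show ?thesis
  proof (rule AE_I')
    have sets: "(if j = i then N else space (M j)) \<in> sets (M j)" for j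
      using N by auto
    have "emeasure (Pi\<^sub>M I M) ?N = (\<Prod>j\<in>I. emeasure (M j) (if j = i then N else space (M j)))"
      using I sets by (intro emeasure_PiM) auto
    also have "\<dots> = 0" using I N(1) by (intro prod_zero) (auto intro!: bexI[of _ i])
    finally show "?N \<in> null_sets (Pi\<^sub>M I M)"
      using I sets by (auto simp: null_sets_def intro!: sets_PiM_I_finite)
    show "{x \<in> space (Pi\<^sub>M I M). \<not> P (x i)} \<subseteq> ?N"
      using N I by (auto simp: space_PiM PiE_def extensional_def Pi_iff)
  qed
qed

abbreviation Leb :: "nat \<Rightarrow> (nat \<Rightarrow> real) measure" where
  "Leb d \<equiv> \<Pi>\<^sub>M j\<in>{..<d}. lborel"

interpretation Leb: product_sigma_finite "\<lambda>_::nat. lborel :: real measure"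
  by (simp add: product_sigma_finite_def lborel.sigma_finite_measure_axioms)

lemma sigma_finite_Leb: "sigma_finite_measure (Leb d)"
  by (rule Leb.sigma_finite) simp

lemma space_Leb: "space (Leb d) = Rn d"
  by (simp add: space_PiM Rn_def)

lemma eucl_norm_measurable [measurable]: "eucl_norm d \<in> borel_measurable (Leb d)"
  unfolding eucl_norm_def L2_set_def by measurable

lemma dilate_measurable [measurable]: "dilate d c \<in> Leb d \<rightarrow>\<^sub>M Leb d"
  unfolding dilate_def by measurable

lemma dilate_in_Rn [simp]: "dilate d c u \<in> Rn d"
  by (simp add: dilate_def Rn_def)

lemma eucl_norm_nonneg [simp]: "0 \<le> eucl_norm d u"
  by (simp add: eucl_norm_def L2_set_nonneg)

lemma eucl_norm_dilate: "eucl_norm d (dilate d c u) = \<bar>c\<bar> * eucl_norm d u"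
proof -
  have "eucl_norm d (dilate d c u) = L2_set (\<lambda>j. c * u j) {..<d}"
    unfolding eucl_norm_def by (rule L2_set_cong) (auto simp: dilate_def)
  also have "\<dots> = sqrt (c\<^sup>2 * (\<Sum>j<d. (u j)\<^sup>2))"
    by (simp add: L2_set_def power_mult_distrib sum_distrib_left)
  finally show ?thesis
    by (simp add: eucl_norm_def L2_set_def real_sqrt_mult)
qed

lemma eucl_norm_eq_0_iff: "u \<in> Rn d \<Longrightarrow> eucl_norm d u = 0 \<longleftrightarrow> u = origin d"
  by (auto simp: eucl_norm_def L2_set_eq_0_iff origin_def Rn_def fun_eq_iff PiE_def extensional_def)

lemma dilate_dilate: "dilate d a (dilate d b u) = dilate d (a * b) u"
  by (auto simp: dilate_def fun_eq_iff)

lemma dilate_1: "u \<in> Rn d \<Longrightarrow> dilate d 1 u = u"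
  by (auto simp: dilate_def Rn_def fun_eq_iff PiE_def extensional_def)

lemma first_unit_in_Rn [simp]: "first_unit d \<in> Rn d"
  by (simp add: first_unit_def Rn_def)

lemma eucl_norm_first_unit: "1 \<le> d \<Longrightarrow> eucl_norm d (first_unit d) = 1"
proof -
  assume d: "1 \<le> d"
  have "(\<Sum>j<d. (first_unit d j)\<^sup>2) = (\<Sum>j<d. if j = 0 then 1 else 0)"
    by (rule sum.cong) (auto simp: first_unit_def)
  also have "\<dots> = 1" using d by simp
  finally show ?thesis by (simp add: eucl_norm_def L2_set_def)
qed

lemma abs_coordinate_le_eucl_norm: "j < d \<Longrightarrow> \<bar>u j\<bar> \<le> eucl_norm d u"
  unfolding eucl_norm_def using member_le_L2_set[of "{..<d}" j "\<lambda>j. \<bar>u j\<bar>"]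
  by (simp add: L2_set_def)

text \<open>
  A vector of norm zero has vanishing first coordinate, and hyperplanes are null sets.
\<close>

lemma AE_Leb_eucl_norm_pos:
  assumes "1 \<le> d"
  shows "AE x in Leb d. 0 < eucl_norm d x"
proof -
  have "AE t in lborel. t \<noteq> (0::real)" by (rule AE_lborel_singleton)
  then have "AE x in Leb d. x 0 \<noteq> 0"
    using assms by (intro Leb.AE_PiM_component) auto
  then show ?thesis
  proof eventually_elim
    case (elim x)
    then have "eucl_norm d x \<noteq> 0"
      using assms by (auto simp: eucl_norm_def L2_set_eq_0_iff)
    then show ?case using eucl_norm_nonneg[of d x] by linarith
  qed
qed

text \<open>
  Induction on the dimension: Fubini splits off the last coordinate, to which the substitution rule on
  the line applies.
\<close>

lemma nn_integral_Leb_dilate: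
  assumes f: "f \<in> borel_measurable (Leb d)" and c: "c \<noteq> 0"
  shows "(\<integral>\<^sup>+u. f u \<partial>Leb d) = ennreal (\<bar>c\<bar> ^ d) * (\<integral>\<^sup>+u. f (dilate d c u) \<partial>Leb d)"
  using f
proof (induction d arbitrary: f)
  case 0
  have "dilate 0 c (\<lambda>k. undefined) = (\<lambda>k. undefined)" by (auto simp: dilate_def)
  then show ?case by (simp add: Leb.nn_integral_empty)
next
  case (Suc d)
  note [measurable] = Suc.prems
  interpret sigma_finite_measure "Leb d" by (rule sigma_finite_Leb)
  have ins: "{..<Suc d} = insert d {..<d}" by (simp add: lessThan_Suc)
  have fm[measurable]: "f \<in> borel_measurable (Pi\<^sub>M (insert d {..<d}) (\<lambda>_. lborel))"
    using Suc.prems by (simp add: ins)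
  have upd: "(\<lambda>(x, y). x(d := y)) \<in> Leb d \<Otimes>\<^sub>M lborel \<rightarrow>\<^sub>M Pi\<^sub>M (insert d {..<d}) (\<lambda>_. lborel)"
    by (rule measurable_add_dim)
  have "(\<lambda>z. f ((\<lambda>(x, y). x(d := y)) z)) \<in> borel_measurable (Leb d \<Otimes>\<^sub>M lborel)"
    by (rule measurable_compose[OF upd fm])
  then have f2[measurable]: "(\<lambda>(x, y). f (x(d := y))) \<in> borel_measurable (Leb d \<Otimes>\<^sub>M lborel)"
    by (simp add: case_prod_beta')
  have dil: "dilate (Suc d) c (x(d := y)) = (dilate d c x)(d := c * y)" for x y
    by (auto simp: dilate_def fun_eq_iff)
  have fd: "(\<lambda>u. f (dilate (Suc d) c u)) \<in> borel_measurable (Pi\<^sub>M (insert d {..<d}) (\<lambda>_. lborel))"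
    unfolding ins[symmetric] by measurable
  have g[measurable]: "(\<lambda>x. \<integral>\<^sup>+y. f (x(d := y)) \<partial>lborel) \<in> borel_measurable (Leb d)"
    by measurable
  have inner: "(\<integral>\<^sup>+y. f (x(d := y)) \<partial>lborel) = ennreal \<bar>c\<bar> * (\<integral>\<^sup>+y. f (x(d := c * y)) \<partial>lborel)"
    if "x \<in> space (Leb d)" for x
  proof -
    have "(\<lambda>y. f (x(d := y))) \<in> borel_measurable lborel"
      using f2 that by (rule measurable_Pair2[where f="\<lambda>(x, y). f (x(d := y))", simplified])
    from nn_integral_real_affine[OF _ c, of "\<lambda>y. f (x(d := y))" 0] this
    show ?thesis by simp
  qed
  have "(\<integral>\<^sup>+u. f u \<partial>Leb (Suc d)) = (\<integral>\<^sup>+x. \<integral>\<^sup>+y. f (x(d := y)) \<partial>lborel \<partial>Leb d)"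
    unfolding ins by (rule Leb.product_nn_integral_insert) (use fm in auto)
  also have "\<dots> = ennreal (\<bar>c\<bar> ^ d) * (\<integral>\<^sup>+x. \<integral>\<^sup>+y. f ((dilate d c x)(d := y)) \<partial>lborel \<partial>Leb d)"
    by (rule Suc.IH[OF g])
  also have "(\<integral>\<^sup>+x. \<integral>\<^sup>+y. f ((dilate d c x)(d := y)) \<partial>lborel \<partial>Leb d)
      = (\<integral>\<^sup>+x. ennreal \<bar>c\<bar> * (\<integral>\<^sup>+y. f ((dilate d c x)(d := c * y)) \<partial>lborel) \<partial>Leb d)"
    by (rule nn_integral_cong, rule inner) (simp add: space_Leb)
  also have "\<dots> = ennreal \<bar>c\<bar> * (\<integral>\<^sup>+x. \<integral>\<^sup>+y. f ((dilate d c x)(d := c * y)) \<partial>lborel \<partial>Leb d)"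
  proof (rule nn_integral_cmult)
    have "(\<lambda>(x, y). f ((dilate d c x)(d := c * y))) =
        (\<lambda>z. (\<lambda>(x, y). f (x(d := y))) (dilate d c (fst z), c * snd z))" by auto
    also have "\<dots> \<in> borel_measurable (Leb d \<Otimes>\<^sub>M lborel)"
      by (rule measurable_compose[OF _ f2]) measurable
    finally show "(\<lambda>x. \<integral>\<^sup>+y. f ((dilate d c x)(d := c * y)) \<partial>lborel) \<in> borel_measurable (Leb d)"
      using lborel.borel_measurable_nn_integral by simp
  qed
  also have "(\<integral>\<^sup>+x. \<integral>\<^sup>+y. f ((dilate d c x)(d := c * y)) \<partial>lborel \<partial>Leb d)
      = (\<integral>\<^sup>+u. f (dilate (Suc d) c u) \<partial>Leb (Suc d))"
    unfolding dil[symmetric] ins by (rule Leb.product_nn_integral_insert[symmetric]) (use fd in auto)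
  finally show ?case by (simp add: ennreal_mult' mult.assoc mult.commute mult.left_commute)
qed

lemma nn_integral_Leb_dilate_pair:
  assumes F[measurable]: "case_prod F \<in> borel_measurable (Leb d \<Otimes>\<^sub>M Leb d)" and c: "0 < c"
  shows "(\<integral>\<^sup>+x. \<integral>\<^sup>+y. F x y \<partial>Leb d \<partial>Leb d)
    = (\<integral>\<^sup>+x. \<integral>\<^sup>+y. ennreal (c ^ d * c ^ d) * F (dilate d c x) (dilate d c y) \<partial>Leb d \<partial>Leb d)"
proof -
  interpret sigma_finite_measure "Leb d" by (rule sigma_finite_Leb)
  have c': "c \<noteq> 0" "\<bar>c\<bar> = c" using c by auto
  have Fx: "F x \<in> borel_measurable (Leb d)" if "x \<in> space (Leb d)" for x
    using measurable_Pair2[OF F that] by simp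
  have dil: "dilate d c x \<in> space (Leb d)" for x by (simp add: space_Leb)
  have in1: "(\<integral>\<^sup>+y. F x y \<partial>Leb d) = ennreal (c ^ d) * (\<integral>\<^sup>+y. F x (dilate d c y) \<partial>Leb d)"
    if "x \<in> space (Leb d)" for x
    using nn_integral_Leb_dilate[OF Fx[OF that] c'(1)] by (simp add: c'(2))
  have in2: "ennreal (c ^ d) * (ennreal (c ^ d) * (\<integral>\<^sup>+y. F (dilate d c x) (dilate d c y) \<partial>Leb d))
      = (\<integral>\<^sup>+y. ennreal (c ^ d * c ^ d) * F (dilate d c x) (dilate d c y) \<partial>Leb d)" for x
  proof -
    have "(\<lambda>y. F (dilate d c x) (dilate d c y)) \<in> borel_measurable (Leb d)"
      by (rule measurable_compose[OF dilate_measurable Fx[OF dil]])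
    then show ?thesis using c by (simp add: nn_integral_cmult ennreal_mult mult.assoc)
  qed
  have "(\<lambda>z. case_prod F (fst z, dilate d c (snd z))) \<in> borel_measurable (Leb d \<Otimes>\<^sub>M Leb d)"
    by (rule measurable_compose[OF _ F]) measurable
  then have m1: "(\<lambda>x. \<integral>\<^sup>+y. F x (dilate d c y) \<partial>Leb d) \<in> borel_measurable (Leb d)"
    using borel_measurable_nn_integral[of "\<lambda>x y. F x (dilate d c y)"] by (simp add: case_prod_beta')
  then have m2: "(\<lambda>x. ennreal (c ^ d) * (\<integral>\<^sup>+y. F x (dilate d c y) \<partial>Leb d)) \<in> borel_measurable (Leb d)"
    by simp
  have m3: "(\<lambda>x. ennreal (c ^ d) * (\<integral>\<^sup>+y. F (dilate d c x) (dilate d c y) \<partial>Leb d)) \<in> borel_measurable (Leb d)"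
    by (rule measurable_compose[OF dilate_measurable m2])
  have "(\<integral>\<^sup>+x. \<integral>\<^sup>+y. F x y \<partial>Leb d \<partial>Leb d)
      = (\<integral>\<^sup>+x. ennreal (c ^ d) * (\<integral>\<^sup>+y. F x (dilate d c y) \<partial>Leb d) \<partial>Leb d)"
    by (rule nn_integral_cong) (rule in1)
  also have "\<dots> = ennreal (c ^ d) *
      (\<integral>\<^sup>+x. ennreal (c ^ d) * (\<integral>\<^sup>+y. F (dilate d c x) (dilate d c y) \<partial>Leb d) \<partial>Leb d)"
    using nn_integral_Leb_dilate[OF m2 c'(1)] by (simp only: c'(2))
  also have "\<dots> = (\<integral>\<^sup>+x. ennreal (c ^ d) * (ennreal (c ^ d) *
      (\<integral>\<^sup>+y. F (dilate d c x) (dilate d c y) \<partial>Leb d)) \<partial>Leb d)"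
    by (rule nn_integral_cmult[OF m3, symmetric])
  finally show ?thesis by (simp only: in2)
qed

section \<open>Shears and plane rotations\<close>

lemma shear_measurable:
  assumes "k < d" "l < d"
  shows "(\<lambda>u. u(k := u k + t * u l)) \<in> Leb d \<rightarrow>\<^sub>M Leb d"
proof -
  have "(\<lambda>u. \<lambda>j\<in>{..<d}. if j = k then u k + t * u l else u j) \<in> Leb d \<rightarrow>\<^sub>M Leb d"
  proof (rule measurable_restrict)
    fix j assume "j \<in> {..<d}"
    then have [measurable]: "(\<lambda>u. u j) \<in> borel_measurable (Leb d)"
        "(\<lambda>u. u k) \<in> borel_measurable (Leb d)" "(\<lambda>u. u l) \<in> borel_measurable (Leb d)"
      using assms measurable_component_singleton[of _ "{..<d}" "\<lambda>_. lborel :: real measure"] by auto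
    show "(\<lambda>u. if j = k then u k + t * u l else u j) \<in> Leb d \<rightarrow>\<^sub>M lborel"
      by (cases "j = k") simp_all
  qed
  moreover have "(\<lambda>j\<in>{..<d}. if j = k then u k + t * u l else u j) = u(k := u k + t * u l)"
    if "u \<in> space (Leb d)" for u
    using that assms by (auto simp: space_PiM PiE_def extensional_def fun_eq_iff)
  ultimately show ?thesis by (subst measurable_cong) auto
qed

text \<open>Fubini reduces this to the translation invariance of Lebesgue measure on the line.\<close>

lemma nn_integral_Leb_shear:
  assumes f: "f \<in> borel_measurable (Leb d)" and kl: "k < d" "l < d" "k \<noteq> l"
  shows "(\<integral>\<^sup>+u. f (u(k := u k + t * u l)) \<partial>Leb d) = (\<integral>\<^sup>+u. f u \<partial>Leb d)"
proof -
  let ?J = "{..<d} - {k}"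
  have ins: "{..<d} = insert k ?J" using kl by auto
  have fm: "f \<in> borel_measurable (Pi\<^sub>M (insert k ?J) (\<lambda>_. lborel))" using f ins by simp
  have gm: "(\<lambda>u. f (u(k := u k + t * u l))) \<in> borel_measurable (Pi\<^sub>M (insert k ?J) (\<lambda>_. lborel))"
    using measurable_compose[OF shear_measurable[OF kl(1,2)] f] ins by simp
  have inner: "(\<integral>\<^sup>+y. f (x(k := y + t * x l)) \<partial>lborel) = (\<integral>\<^sup>+y. f (x(k := y)) \<partial>lborel)"
    if x: "x \<in> space (Pi\<^sub>M ?J (\<lambda>_. lborel))" for x
  proof -
    have "(\<lambda>y. x(k := y)) \<in> lborel \<rightarrow>\<^sub>M Pi\<^sub>M (insert k ?J) (\<lambda>_. lborel)"
      using measurable_component_update[OF x, of k] by simp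
    from measurable_compose[OF this fm]
    have "(\<lambda>y. f (x(k := y))) \<in> borel_measurable lborel" .
    from nn_integral_real_affine[of "\<lambda>y. f (x(k := y))" 1 "t * x l"] this
    show ?thesis by (simp add: add.commute)
  qed
  have "(\<integral>\<^sup>+u. f (u(k := u k + t * u l)) \<partial>Leb d)
      = (\<integral>\<^sup>+x. \<integral>\<^sup>+y. f ((x(k := y))(k := (x(k := y)) k + t * (x(k := y)) l)) \<partial>lborel \<partial>Pi\<^sub>M ?J (\<lambda>_. lborel))"
    by (subst ins, rule Leb.product_nn_integral_insert) (use gm in auto)
  also have "\<dots> = (\<integral>\<^sup>+x. \<integral>\<^sup>+y. f (x(k := y)) \<partial>lborel \<partial>Pi\<^sub>M ?J (\<lambda>_. lborel))"
    by (rule nn_integral_cong) (use kl inner in simp)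
  also have "\<dots> = (\<integral>\<^sup>+u. f u \<partial>Leb d)"
    by (subst ins, rule Leb.product_nn_integral_insert[symmetric]) (use fm in auto)
  finally show ?thesis .
qed

text \<open>
  Only rotations in the planes spanned by the coordinate axes \<open>0\<close> and \<open>k\<close> are used; here \<open>c\<close> and \<open>s\<close>
  stand for the cosine and the sine of the angle.
\<close>

definition plane_rotation :: "real \<Rightarrow> real \<Rightarrow> nat \<Rightarrow> (nat \<Rightarrow> real) \<Rightarrow> nat \<Rightarrow> real" where
  "plane_rotation c s k u = u(0 := c * u 0 + s * u k, k := c * u k - s * u 0)"

text \<open>
  The shear factor $t = s / (1 + c)$ is the tangent of half the angle, whence the exclusion of the half turn.
\<close>

lemma plane_rotation_eq_shears:
  assumes "c\<^sup>2 + s\<^sup>2 = 1" "c \<noteq> -1" "0 < k"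
  defines "t \<equiv> s / (1 + c)"
  defines "S \<equiv> \<lambda>u :: nat \<Rightarrow> real. u(0 := u 0 + t * u k)"
  shows "plane_rotation c s k u = S ((S u)(k := S u k + (- s) * S u 0))"
proof -
  have c: "1 + c \<noteq> 0" using assms(2) by linarith
  have "s * s = (1 - c) * (1 + c)" using assms(1) by (simp add: algebra_simps power2_eq_square)
  then have st: "s * t = 1 - c" using c by (simp add: t_def)
  have tc: "t * (1 + c) = s" using c by (simp add: t_def)
  have k: "u k - s * (u 0 + t * u k) = c * u k - s * u 0"
  proof -
    have "u k - s * (u 0 + t * u k) = u k - s * u 0 - (s * t) * u k" by (simp add: algebra_simps)
    then show ?thesis by (simp add: st algebra_simps)
  qed
  have "u 0 + t * u k + t * (c * u k - s * u 0) = u 0 * (1 - s * t) + t * (1 + c) * u k"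
    by (simp add: algebra_simps)
  also have "\<dots> = c * u 0 + s * u k" by (simp add: st tc)
  finally show ?thesis
    using k assms(3) by (auto simp: plane_rotation_def S_def fun_eq_iff)
qed

lemma nn_integral_Leb_plane_rotation:
  assumes f: "f \<in> borel_measurable (Leb d)"
    and k: "0 < k" "k < d" and cs: "c\<^sup>2 + s\<^sup>2 = 1" "c \<noteq> -1"
  shows "(\<integral>\<^sup>+u. f (plane_rotation c s k u) \<partial>Leb d) = (\<integral>\<^sup>+u. f u \<partial>Leb d)"
proof -
  let ?S = "\<lambda>u :: nat \<Rightarrow> real. u(0 := u 0 + s / (1 + c) * u k)"
  let ?S' = "\<lambda>u :: nat \<Rightarrow> real. u(k := u k + (- s) * u 0)"
  have d: "0 < d" using k by simp
  have S: "?S \<in> Leb d \<rightarrow>\<^sub>M Leb d" by (rule shear_measurable[OF d k(2)])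
  have S': "?S' \<in> Leb d \<rightarrow>\<^sub>M Leb d" by (rule shear_measurable[OF k(2) d])
  have fS: "(\<lambda>u. f (?S u)) \<in> borel_measurable (Leb d)" by (rule measurable_compose[OF S f])
  have fSS: "(\<lambda>u. f (?S (?S' u))) \<in> borel_measurable (Leb d)" by (rule measurable_compose[OF S' fS])
  have "(\<integral>\<^sup>+u. f (plane_rotation c s k u) \<partial>Leb d) = (\<integral>\<^sup>+u. f (?S (?S' (?S u))) \<partial>Leb d)"
    by (simp only: plane_rotation_eq_shears[OF cs k(1)])
  also have "\<dots> = (\<integral>\<^sup>+u. f (?S (?S' u)) \<partial>Leb d)"
    by (rule nn_integral_Leb_shear[OF fSS d k(2)]) (use k in simp)
  also have "\<dots> = (\<integral>\<^sup>+u. f (?S u) \<partial>Leb d)"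
    by (rule nn_integral_Leb_shear[OF fS k(2) d]) (use k in simp)
  also have "\<dots> = (\<integral>\<^sup>+u. f u \<partial>Leb d)"
    by (rule nn_integral_Leb_shear[OF f d k(2)]) (use k in simp)
  finally show ?thesis .
qed

definition plane_rotation_mat :: "nat \<Rightarrow> real \<Rightarrow> real \<Rightarrow> nat \<Rightarrow> real mat" where
  "plane_rotation_mat d c s k = mat d d (\<lambda>(i, j).
     if i = 0 then (if j = 0 then c else if j = k then s else 0)
     else if i = k then (if j = 0 then - s else if j = k then c else 0)
     else if i = j then 1 else 0)"

lemma sum_split_0_k:
  fixes g :: "nat \<Rightarrow> real"
  assumes "0 < k" "k < d"
  shows "(\<Sum>j<d. g j) = g 0 + g k + (\<Sum>j\<in>{..<d} - {0, k}. g j)"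
proof -
  have "(\<Sum>j<d. g j) = (\<Sum>j\<in>{0, k}. g j) + (\<Sum>j\<in>{..<d} - {0, k}. g j)"
    by (subst sum.subset_diff[of "{0, k}"]) (use assms in \<open>auto simp: add.commute\<close>)
  then show ?thesis using assms by simp
qed

lemma mat_apply_plane_rotation_mat:
  assumes k: "0 < k" "k < d" and u: "u \<in> Rn d"
  shows "mat_apply d (plane_rotation_mat d c s k) u = plane_rotation c s k u"
proof
  fix i
  show "mat_apply d (plane_rotation_mat d c s k) u i = plane_rotation c s k u i"
  proof (cases "i < d")
    case False
    then show ?thesis using u k
      by (auto simp: mat_apply_def plane_rotation_def Rn_def PiE_def extensional_def)
  next
    case True
    let ?M = "plane_rotation_mat d c s k"
    have e: "mat_apply d ?M u i = (\<Sum>j<d. ?M $$ (i, j) * u j)"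
      using True by (simp add: mat_apply_def)
    consider "i = 0" | "i = k" | "i \<noteq> 0" "i \<noteq> k" by blast
    then show ?thesis
    proof cases
      case 3
      have "(\<Sum>j<d. ?M $$ (i, j) * u j) = (\<Sum>j<d. if i = j then u j else 0)"
        by (rule sum.cong) (use True 3 in \<open>auto simp: plane_rotation_mat_def\<close>)
      then show ?thesis using e True 3 by (simp add: plane_rotation_def)
    qed (use e True k in \<open>simp_all add: sum_split_0_k[OF k] plane_rotation_def plane_rotation_mat_def\<close>)
  qed
qed

text \<open>
  Row additions leave the determinant unchanged, and the three shears express the matrix as the result
  of three row additions applied to the identity.  Orthogonality is checked entrywise.
\<close>

lemma plane_rotation_mat_in_SO:
  assumes k: "0 < k" "k < d" and cs: "c\<^sup>2 + s\<^sup>2 = 1" "c \<noteq> -1"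
  shows "plane_rotation_mat d c s k \<in> SO d"
proof -
  let ?M = "plane_rotation_mat d c s k"
  define t where "t = s / (1 + c)"
  have M: "?M \<in> carrier_mat d d" by (simp add: plane_rotation_mat_def)
  have c: "1 + c \<noteq> 0" using cs(2) by linarith
  have "s * s = (1 - c) * (1 + c)" using cs(1) by (simp add: algebra_simps power2_eq_square)
  then have st: "s * t = 1 - c" using c by (simp add: t_def)
  have "t * (1 + c) = s" using c by (simp add: t_def)
  then have tc: "t + t * c = s" by (simp only: distrib_left mult_1_right)
  have c1: "c = 1 - s * t" using st by simp
  from tc have "s = t * (1 - s * t) + t" unfolding c1[symmetric] by simp
  with c1 have e: "c = 1 - s * t" "s = t * (1 - s * t) + t" "c = 1 - t * s" by (auto simp: mult.commute)
  have "?M * transpose_mat ?M = 1\<^sub>m d"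
  proof (rule eq_matI)
    fix i j assume ij: "i < dim_row (1\<^sub>m d)" "j < dim_col (1\<^sub>m d)"
    then have ij: "i < d" "j < d" by auto
    have "(?M * transpose_mat ?M) $$ (i, j) = (\<Sum>l<d. ?M $$ (i, l) * ?M $$ (j, l))"
      using ij M by (simp add: scalar_prod_def plane_rotation_mat_def atLeast0LessThan)
    also have "\<dots> = ?M $$ (i, 0) * ?M $$ (j, 0) + ?M $$ (i, k) * ?M $$ (j, k) +
        (\<Sum>l\<in>{..<d} - {0, k}. ?M $$ (i, l) * ?M $$ (j, l))"
      by (rule sum_split_0_k[OF k])
    also have "(\<Sum>l\<in>{..<d} - {0, k}. ?M $$ (i, l) * ?M $$ (j, l))
        = (\<Sum>l\<in>{..<d} - {0, k}. if l = i then (if i = j then 1 else 0) else 0)"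
      by (rule sum.cong) (use ij in \<open>auto simp: plane_rotation_mat_def\<close>)
    also have "\<dots> = (if i \<noteq> 0 \<and> i \<noteq> k \<and> i = j then 1 else 0)"
      using ij by simp
    finally show "(?M * transpose_mat ?M) $$ (i, j) = 1\<^sub>m d $$ (i, j)"
      using ij k cs(1) by (simp add: plane_rotation_mat_def power2_eq_square)
  qed (use M in auto)
  moreover have "?M = addrow t 0 k (addrow (- s) k 0 (addrow t 0 k (1\<^sub>m d)))"
  proof (rule eq_matI)
    fix i j assume "i < dim_row (addrow t 0 k (addrow (- s) k 0 (addrow t 0 k (1\<^sub>m d))))"
      "j < dim_col (addrow t 0 k (addrow (- s) k 0 (addrow t 0 k (1\<^sub>m d))))"
    then have ij: "i < d" "j < d" by auto
    show "?M $$ (i, j) = addrow t 0 k (addrow (- s) k 0 (addrow t 0 k (1\<^sub>m d))) $$ (i, j)"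
      using ij k by (auto simp: plane_rotation_mat_def) (rule e)+
  qed (use M in auto)
  moreover have "Determinant.det (addrow t 0 k (addrow (- s) k 0 (addrow t 0 k (1\<^sub>m d)))) = 1"
    using k by (simp add: det_addrow[of _ d])
  ultimately show ?thesis using M by (simp add: SO_def)
qed

lemma plane_rotation_in_Rn:
  "u \<in> Rn d \<Longrightarrow> 0 < k \<Longrightarrow> k < d \<Longrightarrow> plane_rotation c s k u \<in> Rn d"
  by (auto simp: plane_rotation_def Rn_def PiE_def extensional_def)

lemma eucl_norm_plane_rotation:
  assumes k: "0 < k" "k < d" and cs: "c\<^sup>2 + s\<^sup>2 = 1"
  shows "eucl_norm d (plane_rotation c s k u) = eucl_norm d u"
proof -
  have "(c * u 0 + s * u k)\<^sup>2 + (c * u k - s * u 0)\<^sup>2 = (c\<^sup>2 + s\<^sup>2) * ((u 0)\<^sup>2 + (u k)\<^sup>2)"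
    by (simp add: power2_eq_square algebra_simps)
  then have "(\<Sum>j<d. (plane_rotation c s k u j)\<^sup>2) = (\<Sum>j<d. (u j)\<^sup>2)"
    using k cs by (simp add: sum_split_0_k[OF k] plane_rotation_def)
  then show ?thesis by (simp add: eucl_norm_def L2_set_def)
qed

text \<open>
  Rotations in the coordinate planes containing the first axis suffice to carry any vector to a
  multiple of the first unit vector: each one clears one further coordinate.  A vector on the negative
  half of the first axis is first turned by a quarter.
\<close>

lemma plane_rotation_invariant_imp_radial:
  assumes inv: "\<And>c s k u. 0 < k \<Longrightarrow> k < d \<Longrightarrow> c\<^sup>2 + s\<^sup>2 = 1 \<Longrightarrow> c \<noteq> -1 \<Longrightarrow> u \<in> Rn d \<Longrightarrow>
      \<Phi> (plane_rotation c s k u) = \<Phi> u"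
    and d: "2 \<le> d" and x: "x \<in> Rn d"
  shows "\<Phi> x = \<Phi> (dilate d (eucl_norm d x) (first_unit d))"
proof -
  have clear: "\<exists>y \<in> Rn d. \<Phi> y = \<Phi> x \<and> eucl_norm d y = eucl_norm d x \<and> 0 \<le> y 0 \<and> y k = 0 \<and>
      (\<forall>j. j \<noteq> 0 \<longrightarrow> j \<noteq> k \<longrightarrow> y j = x j)"
    if k: "0 < k" "k < d" and x: "x \<in> Rn d" and xk: "x k \<noteq> 0" for k x
  proof -
    define r where "r = sqrt ((x 0)\<^sup>2 + (x k)\<^sup>2)"
    have r2: "r\<^sup>2 = (x 0)\<^sup>2 + (x k)\<^sup>2" by (simp add: r_def)
    have r: "0 < r" using xk by (simp add: r_def sum_power2_gt_zero_iff)
    define c where "c = x 0 / r"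
    define s where "s = x k / r"
    have "c\<^sup>2 + s\<^sup>2 = ((x 0)\<^sup>2 + (x k)\<^sup>2) / r\<^sup>2"
      by (simp add: c_def s_def power_divide add_divide_distrib)
    then have cs: "c\<^sup>2 + s\<^sup>2 = 1" using r by (simp add: r2[symmetric])
    have "s \<noteq> 0" using xk r by (simp add: s_def)
    then have c: "c \<noteq> -1" using cs by auto
    have "c * x 0 + s * x k = r"
    proof -
      have "c * x 0 + s * x k = ((x 0)\<^sup>2 + (x k)\<^sup>2) / r"
        by (simp add: c_def s_def power2_eq_square add_divide_distrib)
      then show ?thesis using r by (simp add: r2[symmetric]) (simp add: power2_eq_square)
    qed
    moreover have "c * x k - s * x 0 = 0" by (simp add: c_def s_def)
    ultimately show ?thesis
      using inv[OF k cs c x] eucl_norm_plane_rotation[OF k cs, of x] plane_rotation_in_Rn[OF x k, of c s] r k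
      by (intro bexI[of _ "plane_rotation c s k x"]) (auto simp: plane_rotation_def)
  qed
  have axis: "\<Phi> x = \<Phi> (dilate d (eucl_norm d x) (first_unit d))"
    if x: "x \<in> Rn d" and x0: "0 \<le> x 0" and xj: "\<And>j. 0 < j \<Longrightarrow> j < d \<Longrightarrow> x j = 0" for x
  proof -
    have "(\<Sum>j<d. (x j)\<^sup>2) = (x 0)\<^sup>2 + (\<Sum>j\<in>{..<d} - {0}. (x j)\<^sup>2)"
      using d by (subst sum.remove[of _ 0]) auto
    also have "(\<Sum>j\<in>{..<d} - {0}. (x j)\<^sup>2) = 0"
      using xj by (intro sum.neutral) auto
    finally have "eucl_norm d x = x 0" using x0 by (simp add: eucl_norm_def L2_set_def)
    then have "dilate d (eucl_norm d x) (first_unit d) = x"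
      using x xj by (auto simp: dilate_def first_unit_def fun_eq_iff Rn_def PiE_def extensional_def)
    then show ?thesis by simp
  qed
  have main: "\<Phi> x = \<Phi> (dilate d (eucl_norm d x) (first_unit d))"
    if "k < d" "x \<in> Rn d" "\<And>j. k < j \<Longrightarrow> j < d \<Longrightarrow> x j = 0" for k x
    using that
  proof (induction k arbitrary: x)
    case 0
    show ?case
    proof (cases "0 \<le> x 0")
      case True
      then show ?thesis using axis 0 by simp
    next
      case False
      have k: "0 < (1::nat)" "1 < d" using d by auto
      define z where "z = plane_rotation 0 1 1 x"
      have z0: "z \<in> Rn d" unfolding z_def by (rule plane_rotation_in_Rn[OF 0(2) k])
      have z: "\<Phi> z = \<Phi> x" "eucl_norm d z = eucl_norm d x" "z 1 \<noteq> 0"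
        unfolding z_def using inv[OF k _ _ 0(2), of 0 1] False
          eucl_norm_plane_rotation[OF k, of 0 1 x]
        by (auto simp: plane_rotation_def)
      have zj: "z j = 0" if "1 < j" "j < d" for j
        using that 0(3)[of j] by (simp add: z_def plane_rotation_def)
      from clear[OF k z0 z(3)] obtain y where
        y: "y \<in> Rn d" "\<Phi> y = \<Phi> z" "eucl_norm d y = eucl_norm d z" "0 \<le> y 0" "y 1 = 0"
          "\<And>j. j \<noteq> 0 \<Longrightarrow> j \<noteq> 1 \<Longrightarrow> y j = z j" by auto
      have "y j = 0" if "0 < j" "j < d" for j
        using y(5) y(6)[of j] zj[of j] that by (cases "j = 1") auto
      from axis[OF y(1,4) this] show ?thesis using y(2,3) z(1,2) by simp
    qed
  next
    case (Suc k)
    show ?case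
    proof (cases "x (Suc k) = 0")
      case True
      then have "x j = 0" if "k < j" "j < d" for j
        using Suc.prems(3)[of j] that by (cases "j = Suc k") auto
      then show ?thesis using Suc.IH Suc.prems by simp
    next
      case False
      from clear[OF _ Suc.prems(1,2) False] obtain y where
        y: "y \<in> Rn d" "\<Phi> y = \<Phi> x" "eucl_norm d y = eucl_norm d x" "y (Suc k) = 0"
          "\<And>j. j \<noteq> 0 \<Longrightarrow> j \<noteq> Suc k \<Longrightarrow> y j = x j" by auto
      have "y j = 0" if "k < j" "j < d" for j
        using y(4) y(5)[of j] Suc.prems(3)[of j] that by (cases "j = Suc k") auto
      from Suc.IH[OF _ y(1) this] show ?thesis using y(2,3) Suc.prems(1) by simp
    qed
  qed
  show ?thesis
    by (rule main[of "d - 1"]) (use d x in auto)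
qed

section \<open>Dyadic shells\<close>

text \<open>
  An indicator function of the radius rather than a set of points, so that it can serve as a
  radial weight.
\<close>

definition annulus :: "int \<Rightarrow> int \<Rightarrow> real \<Rightarrow> ennreal" where
  "annulus a b = indicator {2 powr real_of_int a..<2 powr real_of_int b}"

lemma annulus_measurable [measurable]: "annulus a b \<in> borel_measurable borel"
  unfolding annulus_def by measurable

lemma ennreal_enn2real_annulus [simp]: "ennreal (enn2real (annulus a b r)) = annulus a b r"
  by (auto simp: annulus_def indicator_def)

text \<open>
  Powers of two as radii make dilations by powers of two act as shifts of the bounds.
\<close>

lemma annulus_scale: "annulus a b (2 powr real_of_int k * r) = annulus (a - k) (b - k) r"
proof -
  have "2 powr real_of_int c \<le> 2 powr real_of_int k * r \<longleftrightarrow> 2 powr real_of_int (c - k) \<le> r" for c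
    by (simp add: powr_diff divide_le_eq mult.commute)
  moreover from this have "2 powr real_of_int k * r < 2 powr real_of_int c \<longleftrightarrow> r < 2 powr real_of_int (c - k)" for c
    by (meson not_le)
  ultimately show ?thesis by (simp add: annulus_def indicator_def)
qed

lemma annulus_append: "a \<le> b \<Longrightarrow> b \<le> c \<Longrightarrow> annulus a c r = annulus a b r + annulus b c r"
proof -
  assume "a \<le> b" "b \<le> c"
  then have "2 powr real_of_int a \<le> (2 powr real_of_int b :: real)" "2 powr real_of_int b \<le> (2 powr real_of_int c :: real)"
    by simp_all
  then show ?thesis by (auto simp: annulus_def indicator_def simp del: powr_le_cancel_iff)
qed

lemma nn_integral_annulus_partition:
  assumes "0 < r"
  shows "(\<integral>\<^sup>+k. annulus k (k + 1) r \<partial>count_space UNIV) = 1"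
proof -
  have "annulus k (k + 1) r = indicator {\<lfloor>log 2 r\<rfloor>} k" for k
  proof -
    have "2 powr real_of_int k \<le> r \<longleftrightarrow> real_of_int k \<le> log 2 r"
      using assms by (simp add: le_log_iff)
    moreover have "r < 2 powr real_of_int (k + 1) \<longleftrightarrow> log 2 r < real_of_int (k + 1)"
      using assms by (simp add: log_less_iff)
    ultimately show ?thesis
      using floor_eq_iff[of "log 2 r" k] by (auto simp: annulus_def indicator_def)
  qed
  then show ?thesis by simp
qed

definition shell_mass :: "nat \<Rightarrow> ennreal" where
  "shell_mass d = (\<integral>\<^sup>+x. ennreal (eucl_norm d x powr - real d) * annulus 0 1 (eucl_norm d x) \<partial>Leb d)"

text \<open>The measure $|x|^{-d} dx$ is invariant under dilations, so all dyadic shells have the same mass.\<close>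

lemma nn_integral_dyadic_shell:
  "(\<integral>\<^sup>+x. ennreal (eucl_norm d x powr - real d) * annulus k (k + 1) (eucl_norm d x) \<partial>Leb d) = shell_mass d"
proof -
  let ?c = "2 powr real_of_int k :: real"
  let ?f = "\<lambda>x. ennreal (eucl_norm d x powr - real d) * annulus k (k + 1) (eucl_norm d x)"
  have c: "?c > 0" by simp
  have "(\<integral>\<^sup>+x. ?f x \<partial>Leb d) = ennreal (\<bar>?c\<bar> ^ d) * (\<integral>\<^sup>+x. ?f (dilate d ?c x) \<partial>Leb d)"
    by (rule nn_integral_Leb_dilate) auto
  also have "\<dots> = (\<integral>\<^sup>+x. ennreal (\<bar>?c\<bar> ^ d) * ?f (dilate d ?c x) \<partial>Leb d)"
    by (rule nn_integral_cmult[symmetric]) measurable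
  also have "\<dots> = shell_mass d"
    unfolding shell_mass_def
  proof (rule nn_integral_cong)
    fix x
    have "\<bar>?c\<bar> ^ d * eucl_norm d (dilate d ?c x) powr - real d = eucl_norm d x powr - real d"
      by (simp add: eucl_norm_dilate powr_mult powr_minus powr_realpow)
    then show "ennreal (\<bar>?c\<bar> ^ d) * ?f (dilate d ?c x)
        = ennreal (eucl_norm d x powr - real d) * annulus 0 1 (eucl_norm d x)"
      by (simp add: eucl_norm_dilate annulus_scale mult.assoc[symmetric] ennreal_mult[symmetric])
  qed
  finally show ?thesis .
qed

lemma nn_integral_annulus:
  "(\<integral>\<^sup>+x. ennreal (eucl_norm d x powr - real d) * annulus a (a + int N) (eucl_norm d x) \<partial>Leb d)
     = of_nat N * shell_mass d"
proof (induction N)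
  case 0
  then show ?case by (simp add: annulus_def)
next
  case (Suc N)
  have "annulus a (a + int (Suc N)) r = annulus a (a + int N) r + annulus (a + int N) (a + int N + 1) r" for r
    using annulus_append[of a "a + int N" "a + int (Suc N)"] by (simp add: ac_simps)
  then have "(\<integral>\<^sup>+x. ennreal (eucl_norm d x powr - real d) * annulus a (a + int (Suc N)) (eucl_norm d x) \<partial>Leb d)
     = (\<integral>\<^sup>+x. ennreal (eucl_norm d x powr - real d) * annulus a (a + int N) (eucl_norm d x) +
         ennreal (eucl_norm d x powr - real d) * annulus (a + int N) (a + int N + 1) (eucl_norm d x) \<partial>Leb d)"
    by (simp add: distrib_left)
  also have "\<dots> = of_nat N * shell_mass d + shell_mass d"
    by (subst nn_integral_add) (simp_all add: Suc nn_integral_dyadic_shell)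
  finally show ?case by (simp add: distrib_right add.commute)
qed

lemma shell_mass_finite: "shell_mass d < \<infinity>"
proof -
  let ?Q = "Pi\<^sub>E {..<d} (\<lambda>_. {-2..2::real})"
  have "shell_mass d \<le> (\<integral>\<^sup>+x. indicator ?Q x \<partial>Leb d)"
    unfolding shell_mass_def
  proof (rule nn_integral_mono)
    fix x assume x: "x \<in> space (Leb d)"
    show "ennreal (eucl_norm d x powr - real d) * annulus 0 1 (eucl_norm d x) \<le> indicator ?Q x"
    proof (cases "1 \<le> eucl_norm d x \<and> eucl_norm d x < 2")
      case True
      have "- 2 \<le> x j \<and> x j \<le> 2" if "j < d" for j
      proof -
        have "\<bar>x j\<bar> \<le> eucl_norm d x" by (rule abs_coordinate_le_eucl_norm[OF that])
        with True show ?thesis by linarith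
      qed
      then have "x \<in> ?Q" using x by (auto simp: space_PiM PiE_iff)
      moreover have "eucl_norm d x powr - real d \<le> 1"
      proof -
        have "eucl_norm d x powr - real d \<le> eucl_norm d x powr 0"
          by (rule powr_mono) (use True in auto)
        then show ?thesis using True by simp
      qed
      ultimately show ?thesis using True by (simp add: annulus_def)
    qed (auto simp: annulus_def indicator_def)
  qed
  also have "\<dots> = emeasure (Leb d) ?Q"
    by (rule nn_integral_indicator, rule sets_PiM_I_finite) auto
  also have "\<dots> = (\<Prod>j<d. emeasure lborel {-2..2::real})"
    by (rule Leb.emeasure_PiM) auto
  also have "\<dots> < \<infinity>" by (simp add: ennreal_power[symmetric] power_less_top_ennreal)
  finally show ?thesis .
qed

text \<open>
  If one shell were null for $|x|^{-d} dx$, all of them would be; as they cover everything except the origin,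
  the whole space would be a null set.
\<close>

lemma shell_mass_pos:
  assumes "1 \<le> d"
  shows "0 < shell_mass d"
proof (rule ccontr)
  assume "\<not> 0 < shell_mass d"
  then have zero: "shell_mass d = 0" by (simp add: not_less)
  have "AE x in Leb d. ennreal (eucl_norm d x powr - real d) * annulus k (k + 1) (eucl_norm d x) = 0" for k
    by (subst nn_integral_0_iff_AE[symmetric]) (simp_all only: nn_integral_dyadic_shell zero, measurable)
  then have "AE x in Leb d. \<forall>k. ennreal (eucl_norm d x powr - real d) * annulus k (k + 1) (eucl_norm d x) = 0"
    unfolding AE_all_countable by (rule allI)
  with AE_Leb_eucl_norm_pos[OF assms] have "AE x in Leb d. False"
  proof eventually_elim
    case (elim x)
    then have "annulus k (k + 1) (eucl_norm d x) = 0" for k by auto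
    then show False using nn_integral_annulus_partition[OF elim(1)] by simp
  qed
  then have "emeasure (Leb d) (space (Leb d)) = 0"
    by (subst (asm) AE_iff_measurable[where N = "space (Leb d)"]) auto
  moreover have "emeasure (Leb d) (Pi\<^sub>E {..<d} (\<lambda>_. UNIV)) = (\<Prod>j<d. emeasure lborel (UNIV :: real set))"
    by (rule Leb.emeasure_PiM) auto
  ultimately show False using assms by (simp add: space_PiM)
qed

section \<open>Integrability of a radial majorant\<close>

lemma nn_integral_even_le:
  fixes h :: "real \<Rightarrow> ennreal"
  assumes [measurable]: "h \<in> borel_measurable borel" and even: "\<And>t. h (- t) = h t"
  shows "(\<integral>\<^sup>+t. h t \<partial>lborel) \<le> 2 * (\<integral>\<^sup>+t. h t * indicator {0..} t \<partial>lborel)"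
proof -
  have "(\<integral>\<^sup>+t. h t \<partial>lborel) \<le> (\<integral>\<^sup>+t. h t * indicator {0..} t + h t * indicator {0..} (- t) \<partial>lborel)"
    by (rule nn_integral_mono) (auto simp: indicator_def)
  also have "\<dots> = (\<integral>\<^sup>+t. h t * indicator {0..} t \<partial>lborel) + (\<integral>\<^sup>+t. h t * indicator {0..} (- t) \<partial>lborel)"
    by (rule nn_integral_add) auto
  also have "(\<integral>\<^sup>+t. h t * indicator {0..} (- t) \<partial>lborel) = (\<integral>\<^sup>+t. h t * indicator {0..} t \<partial>lborel)"
    using nn_integral_real_affine[of "\<lambda>t. h t * indicator {0..} t" "-1" 0] even by simp
  finally show ?thesis by (simp add: mult_2[symmetric])
qed

lemma nn_integral_line_powr_finite:
  assumes b: "0 < b" "b < 1"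
  shows "(\<integral>\<^sup>+t. ennreal (\<bar>t\<bar> powr - b * (1 + t\<^sup>2) powr - (1/2)) \<partial>lborel) < \<infinity>"
proof -
  let ?h = "\<lambda>t::real. \<bar>t\<bar> powr - b * (1 + t\<^sup>2) powr - (1/2)"
  let ?f = "\<lambda>t::real. (if t \<in> {0..1} then t powr - b else 0)"
  let ?g = "\<lambda>t::real. (if t \<in> {1..} then t powr (- b - 1) else 0)"
  have f: "(\<integral>\<^sup>+t. ennreal (?f t) \<partial>lborel) < \<infinity>"
  proof -
    have "(?f has_integral (1 powr (- b + 1) / (- b + 1))) UNIV"
      unfolding has_integral_restrict_UNIV by (rule has_integral_powr_from_0) (use b in auto)
    then have "(\<integral>\<^sup>+t. ennreal (?f t) \<partial>lborel) = ennreal (1 powr (- b + 1) / (- b + 1))"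
      by (intro nn_integral_has_integral_lborel) auto
    then show ?thesis by simp
  qed
  have g: "(\<integral>\<^sup>+t. ennreal (?g t) \<partial>lborel) < \<infinity>"
  proof -
    have "(?g has_integral (- (1 powr (- b - 1 + 1)) / (- b - 1 + 1))) UNIV"
      unfolding has_integral_restrict_UNIV by (rule has_integral_powr_to_inf) (use b in auto)
    then have "(\<integral>\<^sup>+t. ennreal (?g t) \<partial>lborel) = ennreal (- (1 powr (- b - 1 + 1)) / (- b - 1 + 1))"
      by (intro nn_integral_has_integral_lborel) auto
    then show ?thesis by simp
  qed
  have le: "ennreal (?h t) * indicator {0..} t \<le> ennreal (?f t) + ennreal (?g t)" for t
  proof (cases "0 \<le> t")
    case t: True
    have "?h t \<le> ?f t + ?g t"
    proof (cases "t \<le> 1")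
      case True
      have "(1 + t\<^sup>2) powr - (1/2) \<le> (1 + t\<^sup>2) powr 0"
        by (rule powr_mono) auto
      also have "\<dots> = 1" by (simp add: add_nonneg_eq_0_iff)
      finally have "(1 + t\<^sup>2) powr - (1/2) \<le> 1" .
      then have "?h t \<le> t powr - b" using t by (simp add: mult_left_le)
      moreover have "0 \<le> ?g t" by simp
      ultimately show ?thesis using t True by simp
    next
      case False
      have "(1 + t\<^sup>2) powr - (1/2) \<le> (t\<^sup>2) powr - (1/2)"
        by (rule powr_mono2') (use False in auto)
      also have "\<dots> = t powr - 1"
        using False by (simp add: powr_powr flip: powr_numeral)
      finally have "?h t \<le> t powr - b * t powr - 1"
        unfolding abs_of_nonneg[OF t] by (rule mult_left_mono) simp
      also have "\<dots> = ?g t" using False by (simp add: powr_diff)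
      finally show ?thesis using False by simp
    qed
    then show ?thesis using t by (simp add: ennreal_plus[symmetric] del: ennreal_plus)
  qed simp
  have "(\<integral>\<^sup>+t. ennreal (?h t) \<partial>lborel) \<le> 2 * (\<integral>\<^sup>+t. ennreal (?h t) * indicator {0..} t \<partial>lborel)"
    by (rule nn_integral_even_le) auto
  also have "\<dots> \<le> 2 * (\<integral>\<^sup>+t. ennreal (?f t) + ennreal (?g t) \<partial>lborel)"
    by (intro mult_left_mono nn_integral_mono le) auto
  also have "\<dots> = 2 * ((\<integral>\<^sup>+t. ennreal (?f t) \<partial>lborel) + (\<integral>\<^sup>+t. ennreal (?g t) \<partial>lborel))"
    by (subst nn_integral_add) auto
  also have "\<dots> < \<infinity>" using f g by (simp add: ennreal_mult_less_top)
  finally show ?thesis .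
qed

text \<open>
  The integrand is a decreasing function of $|y|$, and it is the $d$-th power of
  $h(|y|)$ with $h(t) = |t|^{-a/d} (1 + t^2)^{-1/2}$.  As $|y_j| \le |y|$, it is at most
  $\prod_j h(y_j)$, and the integral of this product is a power of a one-dimensional integral.  The
  exponent $a/d$ lies strictly between $0$ and $1$, which makes $h$ integrable both at $0$ and at infinity.
\<close>

lemma nn_integral_radial_majorant_finite:
  assumes d: "1 \<le> d" and a: "0 < a" "a < real d"
  shows "(\<integral>\<^sup>+y. ennreal (eucl_norm d y powr - a * (1 + (eucl_norm d y)\<^sup>2) powr - (real d / 2)) \<partial>Leb d) < \<infinity>"
proof -
  let ?b = "a / real d"
  let ?h = "\<lambda>t::real. \<bar>t\<bar> powr - ?b * (1 + t\<^sup>2) powr - (1/2)"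
  have b: "0 < ?b" "?b < 1" using a d by auto
  have ae: "AE y in Leb d. \<forall>j\<in>{..<d}. y j \<noteq> 0"
    by (intro AE_finite_allI Leb.AE_PiM_component AE_lborel_singleton) auto
  have "(\<integral>\<^sup>+y. ennreal (eucl_norm d y powr - a * (1 + (eucl_norm d y)\<^sup>2) powr - (real d / 2)) \<partial>Leb d)
      \<le> (\<integral>\<^sup>+y. (\<Prod>j<d. ennreal (?h (y j))) \<partial>Leb d)"
  proof (rule nn_integral_mono_AE)
    show "AE y in Leb d. ennreal (eucl_norm d y powr - a * (1 + (eucl_norm d y)\<^sup>2) powr - (real d / 2))
        \<le> (\<Prod>j<d. ennreal (?h (y j)))"
      using ae
    proof eventually_elim
      case (elim y)
      let ?r = "eucl_norm d y"
      have yj: "\<bar>y j\<bar> \<le> ?r" if "j < d" for j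
        by (rule abs_coordinate_le_eucl_norm[OF that])
      have r: "0 < ?r" using yj[of 0] elim[rule_format, of 0] d by auto
      have "?h ?r \<le> ?h (y j)" if j: "j < d" for j
      proof (rule mult_mono)
        have y0: "0 < \<bar>y j\<bar>" using elim j by auto
        show "\<bar>?r\<bar> powr - ?b \<le> \<bar>y j\<bar> powr - ?b"
          by (rule powr_mono2') (use b yj[OF j] y0 in auto)
        have "(y j)\<^sup>2 \<le> ?r\<^sup>2" using yj[OF j] by (metis abs_le_square_iff abs_of_nonneg eucl_norm_nonneg)
        then show "(1 + ?r\<^sup>2) powr - (1/2) \<le> (1 + (y j)\<^sup>2) powr - (1/2)"
          by (intro powr_mono2') (auto intro: add_pos_nonneg)
      qed auto
      then have "(\<Prod>j<d. ?h ?r) \<le> (\<Prod>j<d. ?h (y j))"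
        by (intro prod_mono) auto
      moreover have "(\<Prod>j<d. ?h ?r) = ?r powr - a * (1 + ?r\<^sup>2) powr - (real d / 2)"
      proof -
        have "(?r powr - ?b) ^ d = ?r powr - a"
          using r d by (simp add: powr_power)
        moreover have "((1 + ?r\<^sup>2) powr - (1/2)) ^ d = (1 + ?r\<^sup>2) powr - (real d / 2)"
          using d by (simp add: powr_power add_nonneg_eq_0_iff)
        ultimately show ?thesis by (simp add: power_mult_distrib)
      qed
      ultimately show ?case by (simp add: prod_ennreal ennreal_leI)
    qed
  qed
  also have "\<dots> = (\<Prod>j<d. \<integral>\<^sup>+t. ennreal (?h t) \<partial>lborel)"
    by (rule Leb.product_nn_integral_prod) auto
  also have "\<dots> < \<infinity>"
    using nn_integral_line_powr_finite[OF b] by (simp add: power_less_top_ennreal)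
  finally show ?thesis .
qed

section \<open>Topology of $R^d$\<close>

text \<open>
  The kernels are continuous for the product topology on functions; this inclusion makes them
  measurable for the product measure.
\<close>

lemma Leb_to_borel_measurable: "(\<lambda>u. u) \<in> Leb d \<rightarrow>\<^sub>M borel"
proof (rule measurable_coordinatewise_then_product)
  fix j
  show "(\<lambda>u. u j) \<in> borel_measurable (Leb d)"
  proof (cases "j < d")
    case True
    then show ?thesis using measurable_component_singleton[of j "{..<d}" "\<lambda>_. lborel :: real measure"] by simp
  next
    case False
    then have "u j = undefined" if "u \<in> space (Leb d)" for u
      using that by (auto simp: space_PiM PiE_def extensional_def)
    then show ?thesis by (subst measurable_cong[where g = "\<lambda>_. undefined"]) auto
  qed
qed

lemma continuous_coordinate: "continuous_on S (\<lambda>u :: nat \<Rightarrow> real. u j)"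
  by (rule continuous_on_subset[OF continuous_on_product_coordinates]) simp

lemma closed_Rn: "closed (Rn d)"
proof -
  have "Rn d = (\<Inter>j\<in>{d..}. {u. u j = undefined})"
    by (auto simp: Rn_def PiE_def extensional_def)
  also have "closed \<dots>"
    by (intro closed_INT ballI closed_Collect_eq continuous_coordinate continuous_intros)
  finally show ?thesis .
qed

lemma continuous_eucl_norm: "continuous_on S (eucl_norm d)"
  unfolding eucl_norm_def L2_set_def by (intro continuous_intros continuous_coordinate)

lemma origin_in_Rn [simp]: "origin d \<in> Rn d"
  by (simp add: origin_def Rn_def)

lemma eucl_norm_origin [simp]: "eucl_norm d (origin d) = 0"
  by (simp add: eucl_norm_eq_0_iff)

text \<open>
  A closed subset of the square of a cube, which is compact by Tychonoff's theorem.
\<close>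

lemma compact_unit_sphere_pairs:
  "compact {(u, v). u \<in> Rn d \<and> v \<in> Rn d \<and> (eucl_norm d u)\<^sup>2 + (eucl_norm d v)\<^sup>2 = 1}" (is "compact ?S")
proof -
  let ?Q = "PiE UNIV (\<lambda>j. if j < d then {-1..1} else {undefined :: real})"
  have "compactin (product_topology (\<lambda>_. euclidean) UNIV) ?Q"
    unfolding compactin_PiE by auto
  then have Q: "compact ?Q" by (simp add: euclidean_product_topology)
  have "closed ((Rn d \<times> Rn d) \<inter> {z. (eucl_norm d (fst z))\<^sup>2 + (eucl_norm d (snd z))\<^sup>2 = 1})"
    by (intro closed_Int closed_Times closed_Rn closed_Collect_eq continuous_intros
        continuous_on_compose2[OF continuous_eucl_norm[of UNIV]]) auto
  also have "(Rn d \<times> Rn d) \<inter> {z. (eucl_norm d (fst z))\<^sup>2 + (eucl_norm d (snd z))\<^sup>2 = 1} = ?S" by auto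
  finally have "closed ?S" .
  moreover have "?S \<subseteq> ?Q \<times> ?Q"
  proof clarify
    fix u v assume uv: "u \<in> Rn d" "v \<in> Rn d" "(eucl_norm d u)\<^sup>2 + (eucl_norm d v)\<^sup>2 = 1"
    have "w \<in> ?Q" if w: "w \<in> Rn d" "(eucl_norm d w)\<^sup>2 \<le> 1" for w
    proof -
      have "eucl_norm d w \<le> 1" using w(2) by (simp add: power2_le_iff_abs_le abs_square_le_1)
      then have "\<bar>w j\<bar> \<le> 1" if "j < d" for j
        using abs_coordinate_le_eucl_norm[OF that, of w] by linarith
      then have "- 1 \<le> w j \<and> w j \<le> 1" if "j < d" for j using that by (auto simp: abs_le_iff minus_le_iff)
      then show ?thesis using w(1) by (auto simp: Rn_def PiE_def extensional_def)
    qed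
    moreover have "(eucl_norm d u)\<^sup>2 \<le> 1" "(eucl_norm d v)\<^sup>2 \<le> 1"
      using uv(3) zero_le_power2[of "eucl_norm d u"] zero_le_power2[of "eucl_norm d v"] by linarith+
    ultimately show "u \<in> ?Q \<and> v \<in> ?Q" using uv by blast
  qed
  ultimately show ?thesis
    using compact_Int_closed[OF compact_Times[OF Q Q], of ?S] by (simp add: Int_absorb1)
qed

section \<open>Rotation invariant homogeneous kernels\<close>

text \<open>
  The hypotheses of the theorem on the kernel of a single dimension, kept apart so that they can be
  applied to the transposed kernel as well.
\<close>

locale homogeneous_kernel =
  fixes d :: nat and K :: "(nat \<Rightarrow> real) \<Rightarrow> (nat \<Rightarrow> real) \<Rightarrow> real"
  assumes dim: "1 \<le> d"
    and nonneg: "\<And>u v. u \<in> Rn d \<Longrightarrow> v \<in> Rn d \<Longrightarrow> 0 \<le> K u v"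
    and cont: "continuous_on (Rn d \<times> Rn d - {(origin d, origin d)}) (\<lambda>(u, v). K u v)"
    and homogeneous: "\<And>u v \<delta>. u \<in> Rn d \<Longrightarrow> v \<in> Rn d \<Longrightarrow> 0 < \<delta> \<Longrightarrow>
      K (dilate d \<delta> u) (dilate d \<delta> v) = \<delta> powr (- real d) * K u v"
    and rotation: "\<And>u v R. u \<in> Rn d \<Longrightarrow> v \<in> Rn d \<Longrightarrow> R \<in> SO d \<Longrightarrow>
      K (mat_apply d R u) (mat_apply d R v) = K u v"
    and reflection: "\<And>u v. d = 1 \<Longrightarrow> u \<in> Rn 1 \<Longrightarrow> v \<in> Rn 1 \<Longrightarrow>
      K (dilate 1 (- 1) u) (dilate 1 (- 1) v) = K u v"

lemma (in homogeneous_kernel) transpose: "homogeneous_kernel d (\<lambda>u v. K v u)"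
proof
  have "continuous_on (Rn d \<times> Rn d - {(origin d, origin d)}) (\<lambda>z. (\<lambda>(u, v). K u v) (prod.swap z))"
    by (rule continuous_on_compose2[OF cont continuous_on_swap]) auto
  then show "continuous_on (Rn d \<times> Rn d - {(origin d, origin d)}) (\<lambda>(u, v). K v u)"
    by (simp add: case_prod_beta' prod.swap_def)
qed (use dim nonneg homogeneous rotation reflection in auto)

context homogeneous_kernel begin

text \<open>
  Off the pair of origins this is continuity; changing the function at one point does not matter.
\<close>

lemma kernel_measurable: "(\<lambda>z. K (fst z) (snd z)) \<in> borel_measurable (Leb d \<Otimes>\<^sub>M Leb d)"
proof -
  let ?o = "(origin d, origin d)"
  let ?X = "Rn d \<times> Rn d - {?o}"
  let ?F = "\<lambda>z. indicator ?X z *\<^sub>R (\<lambda>(u, v). K u v) z + indicator {?o} z * K (origin d) (origin d)"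
  have X: "?X \<in> sets borel"
    by (intro sets.Diff borel_closed closed_Times closed_Rn) auto
  have "?F \<in> borel_measurable borel"
    by (intro borel_measurable_add borel_measurable_continuous_on_indicator X cont borel_measurable_times
        borel_measurable_indicator) auto
  moreover have "(\<lambda>z. z) \<in> Leb d \<Otimes>\<^sub>M Leb d \<rightarrow>\<^sub>M borel"
  proof -
    have "(\<lambda>z. (fst z, snd z)) \<in> Leb d \<Otimes>\<^sub>M Leb d \<rightarrow>\<^sub>M borel"
      by (intro borel_measurable_Pair measurable_compose[OF measurable_fst Leb_to_borel_measurable]
           measurable_compose[OF measurable_snd Leb_to_borel_measurable])
    then show ?thesis by simp
  qed
  ultimately have "(\<lambda>z. ?F z) \<in> borel_measurable (Leb d \<Otimes>\<^sub>M Leb d)"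
    by (rule measurable_compose[rotated])
  then show ?thesis
    by (rule measurable_cong[THEN iffD1, rotated]) (auto simp: space_pair_measure space_Leb indicator_def)
qed

lemma kernel_measurable' [measurable (raw)]:
  assumes "f \<in> M \<rightarrow>\<^sub>M Leb d" "g \<in> M \<rightarrow>\<^sub>M Leb d"
  shows "(\<lambda>z. K (f z) (g z)) \<in> borel_measurable M"
  using measurable_compose[OF measurable_Pair[OF assms] kernel_measurable] by simp

lemma kernel_scale:
  assumes "u \<in> Rn d" "v \<in> Rn d" "0 < c"
  shows "c ^ d * K (dilate d c u) (dilate d c v) = K u v"
  using assms by (simp add: homogeneous powr_minus powr_realpow)

text \<open>
  Homogeneity reduces the estimate to pairs on the unit sphere of $R^d \times R^d$, a compact set on
  which the kernel is continuous.
\<close>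

lemma kernel_bound:
  "\<exists>B\<ge>0. \<forall>u\<in>Rn d. \<forall>v\<in>Rn d. 0 < eucl_norm d u \<longrightarrow>
     K u v \<le> B * ((eucl_norm d u)\<^sup>2 + (eucl_norm d v)\<^sup>2) powr - (real d / 2)"
proof -
  let ?S = "{(u, v). u \<in> Rn d \<and> v \<in> Rn d \<and> (eucl_norm d u)\<^sup>2 + (eucl_norm d v)\<^sup>2 = 1}"
  have "continuous_on ?S (\<lambda>(u, v). K u v)"
    by (rule continuous_on_subset[OF cont]) auto
  from compact_imp_bounded[OF compact_continuous_image[OF this compact_unit_sphere_pairs]]
  obtain B where B: "\<And>z. z \<in> ?S \<Longrightarrow> norm ((\<lambda>(u, v). K u v) z) \<le> B"
    unfolding bounded_iff by blast
  have "K u v \<le> max B 0 * ((eucl_norm d u)\<^sup>2 + (eucl_norm d v)\<^sup>2) powr - (real d / 2)"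
    if uv: "u \<in> Rn d" "v \<in> Rn d" and u: "0 < eucl_norm d u" for u v
  proof -
    define r where "r = sqrt ((eucl_norm d u)\<^sup>2 + (eucl_norm d v)\<^sup>2)"
    have r2: "r\<^sup>2 = (eucl_norm d u)\<^sup>2 + (eucl_norm d v)\<^sup>2" by (simp add: r_def)
    have r: "0 < r" using u by (simp add: r_def add_pos_nonneg)
    let ?u = "dilate d (1 / r) u" and ?v = "dilate d (1 / r) v"
    have "(eucl_norm d ?u)\<^sup>2 + (eucl_norm d ?v)\<^sup>2 = ((eucl_norm d u)\<^sup>2 + (eucl_norm d v)\<^sup>2) / r\<^sup>2"
      using r by (simp add: eucl_norm_dilate power_divide add_divide_distrib)
    also have "\<dots> = 1" using r by (simp add: r2[symmetric])
    finally have "(?u, ?v) \<in> ?S" by simp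
    from B[OF this] have "K ?u ?v \<le> max B 0" by simp
    moreover have "K u v = r powr - real d * K ?u ?v"
      using homogeneous[of ?u ?v r] r uv by (simp add: dilate_dilate dilate_1)
    moreover have "r powr - real d = (r\<^sup>2) powr - (real d / 2)"
      using r by (simp add: powr_powr flip: powr_numeral)
    ultimately show ?thesis by (simp add: r2 mult.commute[of _ "K _ _"] mult_right_mono)
  qed
  then show ?thesis by (intro exI[of _ "max B 0"]) auto
qed

text \<open>
  For the weight $r^{-d/p}$ this is the factor which the kernel contributes to the constant of the theorem.
\<close>

definition moment :: "(real \<Rightarrow> ennreal) \<Rightarrow> ennreal" where
  "moment w = (\<integral>\<^sup>+y. ennreal (K (first_unit d) y) * w (eucl_norm d y) \<partial>Leb d)"

text \<open>
  Substituting $Ry$ for $y$ shows that the integral is invariant under rotations of $x$, so $x$ may be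
  replaced by $|x| e$; the dilation $y \mapsto |x| y$ then cancels against the homogeneity of $K$.  In
  dimension one the reflection takes over the role of the rotations.
\<close>

lemma nn_integral_kernel_radial:
  assumes [measurable]: "w \<in> borel_measurable borel" and x: "x \<in> Rn d" "0 < eucl_norm d x"
  shows "(\<integral>\<^sup>+y. ennreal (K x y) * w (eucl_norm d y) \<partial>Leb d) = moment (\<lambda>r. w (eucl_norm d x * r))"
proof -
  define \<Phi> where "\<Phi> x = (\<integral>\<^sup>+y. ennreal (K x y) * w (eucl_norm d y) \<partial>Leb d)" for x
  have meas: "(\<lambda>y. ennreal (K x y) * w (eucl_norm d y)) \<in> borel_measurable (Leb d)" if "x \<in> Rn d" for x
    using that by (simp add: space_Leb[symmetric])
  have dil: "\<Phi> (dilate d c u) = (\<integral>\<^sup>+y. ennreal (\<bar>c\<bar> ^ d * K (dilate d c u) (dilate d c y)) * w (\<bar>c\<bar> * eucl_norm d y) \<partial>Leb d)"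
    if "c \<noteq> 0" "u \<in> Rn d" for c u
  proof -
    have "\<Phi> (dilate d c u) = ennreal (\<bar>c\<bar> ^ d) *
        (\<integral>\<^sup>+y. ennreal (K (dilate d c u) (dilate d c y)) * w (eucl_norm d (dilate d c y)) \<partial>Leb d)"
      unfolding \<Phi>_def by (rule nn_integral_Leb_dilate[OF meas]) (use that in auto)
    also have "\<dots> = (\<integral>\<^sup>+y. ennreal (\<bar>c\<bar> ^ d) * (ennreal (K (dilate d c u) (dilate d c y)) * w (eucl_norm d (dilate d c y))) \<partial>Leb d)"
      by (rule nn_integral_cmult[symmetric]) (use that in \<open>simp add: space_Leb\<close>)
    also have "\<dots> = (\<integral>\<^sup>+y. ennreal (\<bar>c\<bar> ^ d * K (dilate d c u) (dilate d c y)) * w (\<bar>c\<bar> * eucl_norm d y) \<partial>Leb d)"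
      by (rule nn_integral_cong) (simp add: eucl_norm_dilate ennreal_mult nonneg mult.assoc)
    finally show ?thesis .
  qed
  have "\<Phi> x = \<Phi> (dilate d (eucl_norm d x) (first_unit d))"
  proof (cases "d = 1")
    case False
    show ?thesis
    proof (rule plane_rotation_invariant_imp_radial[of d \<Phi> x])
      fix c s :: real and k u assume h: "0 < k" "k < d" "c\<^sup>2 + s\<^sup>2 = 1" "c \<noteq> -1" "u \<in> Rn d"
      let ?R = "plane_rotation c s k"
      have "\<Phi> (?R u) = (\<integral>\<^sup>+y. ennreal (K (?R u) (?R y)) * w (eucl_norm d (?R y)) \<partial>Leb d)"
        unfolding \<Phi>_def
        by (rule nn_integral_Leb_plane_rotation[symmetric, OF meas]) (use h plane_rotation_in_Rn in auto)
      also have "\<dots> = \<Phi> u"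
        unfolding \<Phi>_def
      proof (rule nn_integral_cong)
        fix y assume "y \<in> space (Leb d)"
        then have y: "y \<in> Rn d" by (simp add: space_Leb)
        have "K (?R u) (?R y) = K u y"
          using rotation[OF h(5) y plane_rotation_mat_in_SO[OF h(1-4)]]
          by (simp add: mat_apply_plane_rotation_mat[OF h(1,2)] h(5) y)
        then show "ennreal (K (?R u) (?R y)) * w (eucl_norm d (?R y)) = ennreal (K u y) * w (eucl_norm d y)"
          by (simp add: eucl_norm_plane_rotation[OF h(1-3)])
      qed
      finally show "\<Phi> (?R u) = \<Phi> u" .
    qed (use False dim x in auto)
  next
    case True
    let ?z = "dilate d (eucl_norm d x) (first_unit d)"
    have ex: "eucl_norm (Suc 0) x = \<bar>x 0\<bar>" by (simp add: eucl_norm_def L2_set_def)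
    have xe: "x j = undefined" if "\<not> j < d" for j
      using x(1) that by (auto simp: Rn_def PiE_def extensional_def)
    show ?thesis
    proof (cases "0 \<le> x 0")
      case nn: True
      have "x = ?z" using True nn xe by (auto simp: fun_eq_iff ex dilate_def first_unit_def)
      then show ?thesis by simp
    next
      case False
      have z: "x = dilate d (-1) ?z" using True False xe by (auto simp: fun_eq_iff ex dilate_def first_unit_def)
      have "\<Phi> (dilate d (-1) ?z) =
          (\<integral>\<^sup>+y. ennreal (K (dilate d (-1) ?z) (dilate d (-1) y)) * w (eucl_norm d y) \<partial>Leb d)"
        by (subst dil) simp_all
      also have "\<dots> = \<Phi> ?z"
        unfolding \<Phi>_def
      proof (rule nn_integral_cong)
        fix y assume "y \<in> space (Leb d)"
        then have "K (dilate d (- 1) ?z) (dilate d (- 1) y) = K ?z y"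
          using reflection[OF True, of ?z y] True by (simp add: space_Leb)
        then show "ennreal (K (dilate d (- 1) ?z) (dilate d (- 1) y)) * w (eucl_norm d y)
            = ennreal (K ?z y) * w (eucl_norm d y)" by simp
      qed
      finally have "\<Phi> (dilate d (-1) ?z) = \<Phi> ?z" .
      with z show ?thesis by simp
    qed
  qed
  also have "\<dots> = moment (\<lambda>r. w (eucl_norm d x * r))"
    unfolding moment_def using x(2)
    by (subst dil) (auto simp: space_Leb kernel_scale intro!: nn_integral_cong)
  finally show ?thesis by (simp add: \<Phi>_def)
qed

text \<open>
  The power $|y|^{-a}$ is a generalised eigenfunction, since $(|x| r)^{-a} = |x|^{-a} r^{-a}$.
\<close>

lemma nn_integral_kernel_powr:
  assumes x: "x \<in> Rn d" "0 < eucl_norm d x"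
  shows "(\<integral>\<^sup>+y. ennreal (K x y) * ennreal (eucl_norm d y powr - a) \<partial>Leb d)
    = ennreal (eucl_norm d x powr - a) * moment (\<lambda>r. ennreal (r powr - a))"
proof -
  have "(\<integral>\<^sup>+y. ennreal (K x y) * ennreal (eucl_norm d y powr - a) \<partial>Leb d)
      = (\<integral>\<^sup>+y. ennreal (K (first_unit d) y) * ennreal ((eucl_norm d x * eucl_norm d y) powr - a) \<partial>Leb d)"
    using nn_integral_kernel_radial[of "\<lambda>r. ennreal (r powr - a)", OF _ x] by (simp add: moment_def)
  also have "\<dots> = (\<integral>\<^sup>+y. ennreal (eucl_norm d x powr - a) *
      (ennreal (K (first_unit d) y) * ennreal (eucl_norm d y powr - a)) \<partial>Leb d)"
    using x by (intro nn_integral_cong) (simp add: powr_mult ennreal_mult ac_simps)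
  also have "\<dots> = ennreal (eucl_norm d x powr - a) * moment (\<lambda>r. ennreal (r powr - a))"
    unfolding moment_def by (rule nn_integral_cmult) (simp add: space_Leb)
  finally show ?thesis .
qed

text \<open>
  The decay of the kernel provides the majorant $B\, |y|^{-a} (1 + |y|^2)^{-d/2}$ of the integrand.
\<close>

lemma moment_powr_finite:
  assumes a: "0 < a" "a < real d"
  shows "moment (\<lambda>r. ennreal (r powr - a)) < \<infinity>"
proof -
  obtain B where B: "0 \<le> B" "\<And>u v. u \<in> Rn d \<Longrightarrow> v \<in> Rn d \<Longrightarrow> 0 < eucl_norm d u \<Longrightarrow>
     K u v \<le> B * ((eucl_norm d u)\<^sup>2 + (eucl_norm d v)\<^sup>2) powr - (real d / 2)"
    using kernel_bound by blast
  let ?h = "\<lambda>y. eucl_norm d y powr - a * (1 + (eucl_norm d y)\<^sup>2) powr - (real d / 2)"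
  have "moment (\<lambda>r. ennreal (r powr - a)) \<le> (\<integral>\<^sup>+y. ennreal B * ennreal (?h y) \<partial>Leb d)"
    unfolding moment_def
  proof (rule nn_integral_mono)
    fix y assume "y \<in> space (Leb d)"
    then have "K (first_unit d) y \<le> B * (1 + (eucl_norm d y)\<^sup>2) powr - (real d / 2)"
      using B(2)[of "first_unit d" y] dim by (simp add: space_Leb eucl_norm_first_unit)
    then have "K (first_unit d) y * eucl_norm d y powr - a
        \<le> B * (1 + (eucl_norm d y)\<^sup>2) powr - (real d / 2) * eucl_norm d y powr - a"
      by (rule mult_right_mono) simp
    then show "ennreal (K (first_unit d) y) * ennreal (eucl_norm d y powr - a) \<le> ennreal B * ennreal (?h y)"
      unfolding ennreal_mult''[OF powr_ge_zero, symmetric]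
      by (subst ennreal_mult''[symmetric]) (auto intro!: ennreal_leI simp: ac_simps)
  qed
  also have "\<dots> = ennreal B * (\<integral>\<^sup>+y. ennreal (?h y) \<partial>Leb d)"
    by (rule nn_integral_cmult) measurable
  also have "\<dots> < \<infinity>"
    using nn_integral_radial_majorant_finite[OF dim a] by (simp add: ennreal_mult_less_top)
  finally show ?thesis .
qed

section \<open>A kernel and its transpose have the same constant\<close>

text \<open>
  The exponents $d - a$ and $a$ make the integrand homogeneous of degree $-2d$.  For $a = d/p$ they are
  $d/q$ and $d/p$.
\<close>

definition shell_pair :: "real \<Rightarrow> int \<Rightarrow> int \<Rightarrow> ennreal" where
  "shell_pair a j k = (\<integral>\<^sup>+x. \<integral>\<^sup>+y.
     ennreal (K x y * (eucl_norm d x powr - (real d - a) * eucl_norm d y powr - a)) *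
     (annulus j (j + 1) (eucl_norm d x) * annulus k (k + 1) (eucl_norm d y)) \<partial>Leb d \<partial>Leb d)"

text \<open>
  Summing over all shells for $y$ removes the restriction on $y$.  The inner integral then is a multiple of
  $|x|^{-a}$, which together with $|x|^{-(d-a)}$ gives the density $|x|^{-d}$ of the shell mass.
\<close>

lemma sum_shell_pair:
  "(\<integral>\<^sup>+k. shell_pair a 0 k \<partial>count_space UNIV) = moment (\<lambda>r. ennreal (r powr - a)) * shell_mass d"
proof -
  interpret sigma_finite_measure "Leb d" by (rule sigma_finite_Leb)
  let ?G = "\<lambda>x y. ennreal (K x y * (eucl_norm d x powr - (real d - a) * eucl_norm d y powr - a))"
  let ?s = "\<lambda>k x. annulus k (k + 1) (eucl_norm d x)"
  have "(\<integral>\<^sup>+k. shell_pair a 0 k \<partial>count_space UNIV)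
      = (\<integral>\<^sup>+x. (\<integral>\<^sup>+k. (\<integral>\<^sup>+y. ?G x y * (?s 0 x * ?s k y) \<partial>Leb d) \<partial>count_space UNIV) \<partial>Leb d)"
    unfolding shell_pair_def by (rule nn_integral_count_space_nn_integral[symmetric]) auto
  also have "\<dots> = (\<integral>\<^sup>+x. (\<integral>\<^sup>+y. (\<integral>\<^sup>+k. ?G x y * (?s 0 x * ?s k y) \<partial>count_space UNIV) \<partial>Leb d) \<partial>Leb d)"
    by (rule nn_integral_cong, rule nn_integral_count_space_nn_integral[symmetric])
      auto
  also have "\<dots> = (\<integral>\<^sup>+x. moment (\<lambda>r. ennreal (r powr - a)) * (ennreal (eucl_norm d x powr - real d) * ?s 0 x) \<partial>Leb d)"
  proof (rule nn_integral_cong_AE)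
    show "AE x in Leb d. (\<integral>\<^sup>+y. (\<integral>\<^sup>+k. ?G x y * (?s 0 x * ?s k y) \<partial>count_space UNIV) \<partial>Leb d)
        = moment (\<lambda>r. ennreal (r powr - a)) * (ennreal (eucl_norm d x powr - real d) * ?s 0 x)"
      using AE_Leb_eucl_norm_pos[OF dim] AE_space
    proof eventually_elim
      case (elim x)
      then have x: "x \<in> Rn d" by (simp add: space_Leb)
      have "(\<integral>\<^sup>+y. (\<integral>\<^sup>+k. ?G x y * (?s 0 x * ?s k y) \<partial>count_space UNIV) \<partial>Leb d)
          = (\<integral>\<^sup>+y. (ennreal (eucl_norm d x powr - (real d - a)) * ?s 0 x) * (ennreal (K x y) * ennreal (eucl_norm d y powr - a)) \<partial>Leb d)"
      proof (rule nn_integral_cong_AE)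
        show "AE y in Leb d. (\<integral>\<^sup>+k. ?G x y * (?s 0 x * ?s k y) \<partial>count_space UNIV)
          = (ennreal (eucl_norm d x powr - (real d - a)) * ?s 0 x) * (ennreal (K x y) * ennreal (eucl_norm d y powr - a))"
          using AE_Leb_eucl_norm_pos[OF dim] AE_space
        proof eventually_elim
          case y: (elim y)
          have "(\<integral>\<^sup>+k. ?G x y * (?s 0 x * ?s k y) \<partial>count_space UNIV) = ?G x y * ?s 0 x"
            by (simp add: nn_integral_cmult nn_integral_annulus_partition[OF y(1)] mult.assoc[symmetric])
          then show ?case using y(2) x by (simp add: ennreal_mult nonneg space_Leb ac_simps)
        qed
      qed
      also have "\<dots> = (ennreal (eucl_norm d x powr - (real d - a)) * ?s 0 x) *
          (ennreal (eucl_norm d x powr - a) * moment (\<lambda>r. ennreal (r powr - a)))"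
        using elim by (subst nn_integral_cmult) (simp_all add: nn_integral_kernel_powr[OF x elim(1)])
      also have "\<dots> = moment (\<lambda>r. ennreal (r powr - a)) *
          ((ennreal (eucl_norm d x powr - (real d - a)) * ennreal (eucl_norm d x powr - a)) * ?s 0 x)"
        by (simp add: ac_simps)
      also have "ennreal (eucl_norm d x powr - (real d - a)) * ennreal (eucl_norm d x powr - a)
          = ennreal (eucl_norm d x powr - real d)"
        by (simp add: ennreal_mult[symmetric] powr_add[symmetric])
      finally show ?case .
    qed
  qed
  also have "\<dots> = moment (\<lambda>r. ennreal (r powr - a)) * shell_mass d"
    unfolding shell_mass_def add_0 by (rule nn_integral_cmult) measurable
  finally show ?thesis .
qed

lemma shell_pair_transpose:
  "homogeneous_kernel.shell_pair d (\<lambda>u v. K v u) (real d - a) j k = shell_pair a k j"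
proof -
  interpret T: homogeneous_kernel d "\<lambda>u v. K v u" by (rule transpose)
  interpret pair_sigma_finite "Leb d" "Leb d" by (simp add: pair_sigma_finite_def sigma_finite_Leb)
  show ?thesis
    unfolding T.shell_pair_def shell_pair_def
    by (subst Fubini') (simp_all add: ac_simps)
qed

text \<open>
  Dilation of both variables by $2^k$; the Jacobian $2^{2dk}$ cancels the homogeneity of the integrand.
\<close>

lemma shell_pair_shift: "shell_pair a 0 k = shell_pair a (- k) 0"
proof -
  define c :: real where "c = 2 powr real_of_int k"
  have c: "0 < c" by (simp add: c_def)
  let ?w = "\<lambda>x y. eucl_norm d x powr - (real d - a) * eucl_norm d y powr - a"
  let ?D = "dilate d c"
  show ?thesis
    unfolding shell_pair_def
  proof (subst nn_integral_Leb_dilate_pair[OF _ c])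
    show "(\<integral>\<^sup>+x. \<integral>\<^sup>+y. ennreal (c ^ d * c ^ d) * (ennreal (K (?D x) (?D y) * ?w (?D x) (?D y)) *
        (annulus 0 (0 + 1) (eucl_norm d (?D x)) * annulus k (k + 1) (eucl_norm d (?D y)))) \<partial>Leb d \<partial>Leb d)
      = (\<integral>\<^sup>+x. \<integral>\<^sup>+y. ennreal (K x y * ?w x y) *
        (annulus (- k) (- k + 1) (eucl_norm d x) * annulus 0 (0 + 1) (eucl_norm d y)) \<partial>Leb d \<partial>Leb d)"
    proof (intro nn_integral_cong)
      fix x y assume "x \<in> space (Leb d)" "y \<in> space (Leb d)"
      then have xy: "x \<in> Rn d" "y \<in> Rn d" by (auto simp: space_Leb)
      have "c powr real d * (c powr - (real d - a) * c powr - a) = c powr (real d + (- (real d - a) + - a))"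
        by (simp only: powr_add)
      then have "c ^ d * (c powr - (real d - a) * c powr - a) = 1"
        using c by (simp add: powr_realpow)
      moreover have "?w (?D x) (?D y) = (c powr - (real d - a) * c powr - a) * ?w x y"
        using c by (simp only: eucl_norm_dilate abs_of_pos powr_mult ac_simps)
      ultimately have w: "c ^ d * ?w (?D x) (?D y) = ?w x y"
        by (simp only: mult.assoc[symmetric])
      have "c ^ d * c ^ d * (K (?D x) (?D y) * ?w (?D x) (?D y)) = (c ^ d * K (?D x) (?D y)) * (c ^ d * ?w (?D x) (?D y))"
        by (simp only: ac_simps)
      then have "c ^ d * c ^ d * (K (?D x) (?D y) * ?w (?D x) (?D y)) = K x y * ?w x y"
        by (simp only: kernel_scale[OF xy c] w)
      then have "ennreal (c ^ d * c ^ d) * ennreal (K (?D x) (?D y) * ?w (?D x) (?D y)) = ennreal (K x y * ?w x y)"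
        using c by (subst ennreal_mult'[symmetric]) simp_all
      moreover have "annulus i j (eucl_norm d (?D z)) = annulus (i - k) (j - k) (eucl_norm d z)" for i j z
        by (simp add: eucl_norm_dilate c_def annulus_scale)
      ultimately show "ennreal (c ^ d * c ^ d) * (ennreal (K (?D x) (?D y) * ?w (?D x) (?D y)) *
        (annulus 0 (0 + 1) (eucl_norm d (?D x)) * annulus k (k + 1) (eucl_norm d (?D y))))
        = ennreal (K x y * ?w x y) *
        (annulus (- k) (- k + 1) (eucl_norm d x) * annulus 0 (0 + 1) (eucl_norm d y))"
        by (simp add: mult.assoc[symmetric])
    qed
  qed measurable
qed

text \<open>
  Both sides multiplied by the shell mass are sums of the same double integrals: one sum lets the shell of
  $y$ vary, the other the shell of $x$, and the shift lemma matches the terms $k$ and $-k$.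
\<close>

lemma moment_transpose:
  "homogeneous_kernel.moment d (\<lambda>u v. K v u) (\<lambda>r. ennreal (r powr - (real d - a)))
    = moment (\<lambda>r. ennreal (r powr - a))"
proof -
  interpret T: homogeneous_kernel d "\<lambda>u v. K v u" by (rule transpose)
  have "T.moment (\<lambda>r. ennreal (r powr - (real d - a))) * shell_mass d
      = (\<integral>\<^sup>+k. shell_pair a k 0 \<partial>count_space UNIV)"
    by (simp only: T.sum_shell_pair[symmetric] shell_pair_transpose)
  also have "\<dots> = (\<integral>\<^sup>+k. shell_pair a (- k) 0 \<partial>count_space UNIV)"
    by (rule nn_integral_bij_count_space[symmetric]) (rule bij_uminus)
  also have "\<dots> = moment (\<lambda>r. ennreal (r powr - a)) * shell_mass d"
    by (simp add: sum_shell_pair[symmetric] shell_pair_shift)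
  finally show ?thesis
    using shell_mass_finite[of d] shell_mass_pos[OF dim]
    by (auto simp: mult.commute[of _ "shell_mass d"] ennreal_mult_cancel_left)
qed

section \<open>Truncated kernel integrals\<close>

text \<open>
  For $1 \le |x| < 2^N$ the cut-off $2^{-L} \le |y| < 2^{N+L}$ contains the cut-off
  $2^{-L} \le |y| / |x| < 2^L$, for which the integral is computed by scaling.
\<close>

lemma truncated_kernel_powr_ge:
  assumes x: "x \<in> Rn d" "0 < eucl_norm d x"
  shows "ennreal (eucl_norm d x powr - a) * moment (\<lambda>r. ennreal (r powr - a) * annulus (- int L) (int L) r) *
      annulus 0 (int N) (eucl_norm d x)
    \<le> (\<integral>\<^sup>+y. ennreal (K x y) * (ennreal (eucl_norm d y powr - a) * annulus (- int L) (int N + int L) (eucl_norm d y)) \<partial>Leb d)"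
proof -
  let ?r = "eucl_norm d x"
  have "ennreal (?r powr - a) * moment (\<lambda>r. ennreal (r powr - a) * annulus (- int L) (int L) r) * annulus 0 (int N) ?r
    = (\<integral>\<^sup>+y. ennreal (?r powr - a) * annulus 0 (int N) ?r * (ennreal (K (first_unit d) y) *
        (ennreal (eucl_norm d y powr - a) * annulus (- int L) (int L) (eucl_norm d y))) \<partial>Leb d)"
    unfolding moment_def by (subst nn_integral_cmult) (simp_all add: space_Leb ac_simps)
  also have "\<dots> \<le> (\<integral>\<^sup>+y. ennreal (K (first_unit d) y) *
        (ennreal ((?r * eucl_norm d y) powr - a) * annulus (- int L) (int N + int L) (?r * eucl_norm d y)) \<partial>Leb d)"
  proof (rule nn_integral_mono)
    fix y
    have "annulus 0 (int N) ?r * annulus (- int L) (int L) s \<le> annulus (- int L) (int N + int L) (?r * s)" for s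
    proof (cases "1 \<le> ?r \<and> ?r < 2 powr int N \<and> 2 powr - int L \<le> s \<and> s < 2 powr int L")
      case True
      have s: "0 < s" using True by (smt (verit) powr_gt_zero)
      have "1 * 2 powr - real L \<le> ?r * s" by (rule mult_mono) (use True s in auto)
      moreover have "?r * s < 2 powr real N * 2 powr real L" by (rule mult_strict_mono) (use True s x in auto)
      ultimately show ?thesis by (simp add: annulus_def powr_add indicator_def)
    qed (auto simp: annulus_def indicator_def)
    then have "ennreal (K (first_unit d) y) * ennreal (?r powr - a) * ennreal (eucl_norm d y powr - a) *
        (annulus 0 (int N) ?r * annulus (- int L) (int L) (eucl_norm d y))
      \<le> ennreal (K (first_unit d) y) * ennreal (?r powr - a) * ennreal (eucl_norm d y powr - a) *
        annulus (- int L) (int N + int L) (?r * eucl_norm d y)"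
      by (intro mult_left_mono) auto
    then show "ennreal (?r powr - a) * annulus 0 (int N) ?r * (ennreal (K (first_unit d) y) *
        (ennreal (eucl_norm d y powr - a) * annulus (- int L) (int L) (eucl_norm d y)))
      \<le> ennreal (K (first_unit d) y) *
        (ennreal ((?r * eucl_norm d y) powr - a) * annulus (- int L) (int N + int L) (?r * eucl_norm d y))"
      using x by (simp add: powr_mult ennreal_mult ac_simps)
  qed
  also have "\<dots> = (\<integral>\<^sup>+y. ennreal (K x y) * (ennreal (eucl_norm d y powr - a) * annulus (- int L) (int N + int L) (eucl_norm d y)) \<partial>Leb d)"
    using nn_integral_kernel_radial[OF _ x, of "\<lambda>r. ennreal (r powr - a) * annulus (- int L) (int N + int L) r"]
    by (simp add: moment_def)
  finally show ?thesis .
qed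

lemma moment_truncated_tendsto:
  "(\<lambda>L. moment (\<lambda>r. ennreal (r powr - a) * annulus (- int L) (int L) r))
     \<longlonglongrightarrow> moment (\<lambda>r. ennreal (r powr - a))"
  unfolding moment_def
proof (rule nn_integral_LIMSEQ)
  have pw: "2 powr - real (Suc L) \<le> (2 powr - real L :: real)" "2 powr real L \<le> (2 powr real (Suc L) :: real)" for L
    by simp_all
  have mono: "annulus (- int L) (int L) r \<le> annulus (- int (Suc L)) (int (Suc L)) r" for L r
    using pw[of L] by (auto simp: annulus_def indicator_def simp del: powr_le_cancel_iff)
  then show "incseq (\<lambda>L y. ennreal (K (first_unit d) y) *
      (ennreal (eucl_norm d y powr - a) * annulus (- int L) (int L) (eucl_norm d y)))"
    by (intro incseq_SucI le_funI mult_left_mono mono) auto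
  show "(\<lambda>y. ennreal (K (first_unit d) y) *
      (ennreal (eucl_norm d y powr - a) * annulus (- int L) (int L) (eucl_norm d y))) \<in> borel_measurable (Leb d)" for L
    by (simp add: space_Leb)
  fix y
  let ?r = "eucl_norm d y"
  show "(\<lambda>L. ennreal (K (first_unit d) y) * (ennreal (?r powr - a) * annulus (- int L) (int L) ?r))
      \<longlonglongrightarrow> ennreal (K (first_unit d) y) * ennreal (?r powr - a)"
  proof (cases "?r = 0")
    case False
    then have r: "0 < ?r" using eucl_norm_nonneg[of d y] by linarith
    have "eventually (\<lambda>L. \<bar>log 2 ?r\<bar> < real L) sequentially"
      using filterlim_real_sequentially by (simp add: filterlim_at_top_dense)
    then have "eventually (\<lambda>L. annulus (- int L) (int L) ?r = 1) sequentially"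
    proof eventually_elim
      case (elim L)
      then have "- real L \<le> log 2 ?r" "log 2 ?r < real L" by auto
      then show ?case using r by (auto simp: annulus_def le_log_iff log_less_iff)
    qed
    then have "eventually (\<lambda>L. ennreal (K (first_unit d) y) * (ennreal (?r powr - a) * annulus (- int L) (int L) ?r)
       = ennreal (K (first_unit d) y) * ennreal (?r powr - a)) sequentially"
      by eventually_elim simp
    then show ?thesis by (rule tendsto_eventually)
  qed simp
qed

end

section \<open>The inequalities of Hoelder and Schur\<close>

text \<open>
  Young's inequality for $f / a^{1/p}$ and $g / b^{1/q}$, integrated.  If $a$ or $b$ vanishes, so does the
  product almost everywhere.
\<close>

lemma Hoelder_nn_integral:
  fixes f g :: "'a \<Rightarrow> real"
  assumes [measurable]: "f \<in> borel_measurable M" "g \<in> borel_measurable M"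
    and f0: "\<And>x. 0 \<le> f x" and g0: "\<And>x. 0 \<le> g x"
    and pq: "1 < p" "1 < q" "1 / p + 1 / q = 1"
    and a: "(\<integral>\<^sup>+x. ennreal (f x powr p) \<partial>M) \<le> ennreal a" "0 \<le> a"
    and b: "(\<integral>\<^sup>+x. ennreal (g x powr q) \<partial>M) \<le> ennreal b" "0 \<le> b"
  shows "(\<integral>\<^sup>+x. ennreal (f x * g x) \<partial>M) \<le> ennreal (a powr (1 / p) * b powr (1 / q))"
proof (cases "a = 0 \<or> b = 0")
  case True
  then have "AE x in M. f x * g x = 0"
  proof
    assume "a = 0"
    then have "(\<integral>\<^sup>+x. ennreal (f x powr p) \<partial>M) = 0" using a by simp
    then have "AE x in M. ennreal (f x powr p) = 0" by (simp add: nn_integral_0_iff_AE)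
    then show ?thesis by eventually_elim (auto simp: ennreal_eq_0_iff)
  next
    assume "b = 0"
    then have "(\<integral>\<^sup>+x. ennreal (g x powr q) \<partial>M) = 0" using b by simp
    then have "AE x in M. ennreal (g x powr q) = 0" by (simp add: nn_integral_0_iff_AE)
    then show ?thesis by eventually_elim (auto simp: ennreal_eq_0_iff)
  qed
  then have "(\<integral>\<^sup>+x. ennreal (f x * g x) \<partial>M) = (\<integral>\<^sup>+x. 0 \<partial>M)"
    by (intro nn_integral_cong_AE) auto
  then show ?thesis by simp
next
  case False
  then have ab: "0 < a" "0 < b" using a b by auto
  let ?A = "a powr (1 / p)" and ?B = "b powr (1 / q)"
  have AB: "0 < ?A" "0 < ?B" using ab by auto
  have "(\<integral>\<^sup>+x. ennreal (f x * g x) \<partial>M)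
      \<le> (\<integral>\<^sup>+x. ennreal (?A * ?B / (a * p)) * ennreal (f x powr p) + ennreal (?A * ?B / (b * q)) * ennreal (g x powr q) \<partial>M)"
  proof (rule nn_integral_mono)
    fix x
    have "f x / ?A * (g x / ?B) \<le> (f x / ?A) powr p / p + (g x / ?B) powr q / q"
      by (rule Youngs_inequality) (use pq f0 g0 in auto)
    also have "\<dots> = f x powr p / (a * p) + g x powr q / (b * q)"
      using ab pq f0 g0 by (simp add: powr_divide powr_powr)
    finally have "?A * ?B * (f x / ?A * (g x / ?B)) \<le> ?A * ?B * (f x powr p / (a * p) + g x powr q / (b * q))"
      using AB by (intro mult_left_mono) auto
    then have "f x * g x \<le> ?A * ?B / (a * p) * f x powr p + ?A * ?B / (b * q) * g x powr q"
      using AB by (simp add: distrib_left)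
    then show "ennreal (f x * g x)
        \<le> ennreal (?A * ?B / (a * p)) * ennreal (f x powr p) + ennreal (?A * ?B / (b * q)) * ennreal (g x powr q)"
      using ab pq by (simp add: ennreal_mult[symmetric] ennreal_plus[symmetric] ennreal_leI del: ennreal_plus)
  qed
  also have "\<dots> = ennreal (?A * ?B / (a * p)) * (\<integral>\<^sup>+x. ennreal (f x powr p) \<partial>M)
      + ennreal (?A * ?B / (b * q)) * (\<integral>\<^sup>+x. ennreal (g x powr q) \<partial>M)"
    by (simp add: nn_integral_add nn_integral_cmult)
  also have "\<dots> \<le> ennreal (?A * ?B / (a * p)) * ennreal a + ennreal (?A * ?B / (b * q)) * ennreal b"
    by (intro add_mono mult_left_mono a b) auto
  also have "\<dots> = ennreal (?A * ?B * (1 / p + 1 / q))"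
    unfolding distrib_left using ab pq(1,2)
    by (simp add: ennreal_mult[symmetric] ennreal_plus[symmetric] del: ennreal_plus)
  finally show ?thesis by (simp add: pq(3))
qed

text \<open>
  Hoelder's inequality for the splitting $k f = (k^{1/p} f / u) (k^{1/q} u)$: the second factor is controlled by
  the row condition.  The $p$-th power of the first one gives the function \<open>H\<close> below, whose integral
  against $u^p$ is controlled by the column condition after exchanging the order of integration.
\<close>

lemma (in sigma_finite_measure) Schur_test:
  fixes k :: "'a \<Rightarrow> 'a \<Rightarrow> real" and f u :: "'a \<Rightarrow> real"
  assumes k[measurable]: "(\<lambda>(x, y). k x y) \<in> borel_measurable (M \<Otimes>\<^sub>M M)"
    and k0: "\<And>x y. x \<in> space M \<Longrightarrow> y \<in> space M \<Longrightarrow> 0 \<le> k x y"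
    and u[measurable]: "u \<in> borel_measurable M" and u_pos: "AE x in M. 0 < u x"
    and pq: "1 < p" "1 < q" "1 / p + 1 / q = 1" and c: "0 \<le> c"
    and row: "AE x in M. (\<integral>\<^sup>+y. ennreal (k x y * u y powr q) \<partial>M) \<le> ennreal (c * u x powr q)"
    and column: "AE y in M. (\<integral>\<^sup>+x. ennreal (k x y * u x powr p) \<partial>M) \<le> ennreal (c * u y powr p)"
    and f[measurable]: "f \<in> borel_measurable M" and f0: "\<And>x. 0 \<le> f x"
    and fp: "(\<integral>\<^sup>+x. ennreal (f x powr p) \<partial>M) < \<infinity>"
  shows "AE x in M. (\<integral>\<^sup>+y. ennreal (k x y * f y) \<partial>M) < \<infinity>" (is ?fin)
    and "(\<integral>\<^sup>+x. ennreal (enn2real (\<integral>\<^sup>+y. ennreal (k x y * f y) \<partial>M) powr p) \<partial>M)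
      \<le> ennreal (c powr p) * (\<integral>\<^sup>+x. ennreal (f x powr p) \<partial>M)" (is ?le)
proof -
  interpret pair_sigma_finite M M by (simp add: pair_sigma_finite_def sigma_finite_measure_axioms)
  have p1: "1 / p * p = 1" using pq by simp
  define H where "H x = (\<integral>\<^sup>+y. ennreal (k x y * (f y / u y) powr p) \<partial>M)" for x
  have H[measurable]: "H \<in> borel_measurable M" unfolding H_def[abs_def] by measurable
  have kx: "(\<lambda>y. k x y) \<in> borel_measurable M" if "x \<in> space M" for x
    using measurable_Pair2[OF k that] by simp
  have ky: "(\<lambda>x. k x y) \<in> borel_measurable M" if "y \<in> space M" for y
    using measurable_Pair1[OF k that] by simp
  have "(\<integral>\<^sup>+x. H x * ennreal (u x powr p) \<partial>M)
      = (\<integral>\<^sup>+x. \<integral>\<^sup>+y. ennreal (k x y * (f y / u y) powr p) * ennreal (u x powr p) \<partial>M \<partial>M)"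
    unfolding H_def
    by (rule nn_integral_cong, rule nn_integral_multc[symmetric]) (use kx in measurable)
  also have "\<dots> = (\<integral>\<^sup>+y. \<integral>\<^sup>+x. ennreal (k x y * (f y / u y) powr p) * ennreal (u x powr p) \<partial>M \<partial>M)"
    by (rule Fubini'[symmetric]) measurable
  also have "\<dots> \<le> (\<integral>\<^sup>+y. ennreal c * ennreal (f y powr p) \<partial>M)"
  proof (rule nn_integral_mono_AE)
    show "AE y in M. (\<integral>\<^sup>+x. ennreal (k x y * (f y / u y) powr p) * ennreal (u x powr p) \<partial>M) \<le> ennreal c * ennreal (f y powr p)"
      using column u_pos AE_space
    proof eventually_elim
      case (elim y)
      have "(\<integral>\<^sup>+x. ennreal (k x y * (f y / u y) powr p) * ennreal (u x powr p) \<partial>M)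
          = (\<integral>\<^sup>+x. ennreal ((f y / u y) powr p) * ennreal (k x y * u x powr p) \<partial>M)"
        by (rule nn_integral_cong) (simp add: k0 elim(3) ennreal_mult[symmetric] ac_simps)
      also have "\<dots> = ennreal ((f y / u y) powr p) * (\<integral>\<^sup>+x. ennreal (k x y * u x powr p) \<partial>M)"
        by (rule nn_integral_cmult) (use ky[OF elim(3)] in measurable)
      also have "\<dots> \<le> ennreal ((f y / u y) powr p) * ennreal (c * u y powr p)"
        by (rule mult_left_mono[OF elim(1)]) simp
      also have "\<dots> = ennreal c * ennreal (f y powr p)"
        using elim(2) c f0[of y] by (simp add: ennreal_mult[symmetric] powr_divide)
      finally show ?case .
    qed
  qed
  also have "\<dots> = ennreal c * (\<integral>\<^sup>+x. ennreal (f x powr p) \<partial>M)"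
    by (rule nn_integral_cmult) measurable
  finally have Hu: "(\<integral>\<^sup>+x. H x * ennreal (u x powr p) \<partial>M) \<le> ennreal c * (\<integral>\<^sup>+x. ennreal (f x powr p) \<partial>M)" .
  also have "\<dots> < \<infinity>" using fp by (simp add: ennreal_mult_less_top)
  finally have "AE x in M. H x * ennreal (u x powr p) \<noteq> \<infinity>"
    by (intro nn_integral_PInf_AE) auto
  with u_pos have H_fin: "AE x in M. H x < \<infinity>"
    by eventually_elim (auto simp: ennreal_mult_eq_top_iff less_top[symmetric])
  have key: "AE x in M. (\<integral>\<^sup>+y. ennreal (k x y * f y) \<partial>M)
      \<le> ennreal (enn2real (H x) powr (1 / p) * (c * u x powr q) powr (1 / q))"
    using H_fin row AE_space
  proof eventually_elim
    case (elim x)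
    note [measurable] = kx[OF elim(3)]
    let ?f = "\<lambda>y. \<bar>k x y\<bar> powr (1 / p) * \<bar>f y / u y\<bar>" and ?g = "\<lambda>y. \<bar>k x y\<bar> powr (1 / q) * \<bar>u y\<bar>"
    have "(\<integral>\<^sup>+y. ennreal (k x y * f y) \<partial>M) = (\<integral>\<^sup>+y. ennreal (?f y * ?g y) \<partial>M)"
    proof (rule nn_integral_cong_AE)
      show "AE y in M. ennreal (k x y * f y) = ennreal (?f y * ?g y)"
        using u_pos AE_space
      proof eventually_elim
        case y: (elim y)
        have "k x y = k x y powr (1 / p) * k x y powr (1 / q)"
          using k0[OF elim(3) y(2)] pq(3) by (simp add: powr_add[symmetric])
        then have "k x y * f y = k x y powr (1 / p) * (f y / u y) * (k x y powr (1 / q) * u y)"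
          using y(1) by simp
        then show ?case using k0[OF elim(3) y(2)] y(1) f0[of y] by simp
      qed
    qed
    also have "\<dots> \<le> ennreal (enn2real (H x) powr (1 / p) * (c * u x powr q) powr (1 / q))"
    proof (rule Hoelder_nn_integral[OF _ _ _ _ pq])
      have "(\<integral>\<^sup>+y. ennreal (?f y powr p) \<partial>M) = H x"
        unfolding H_def
      proof (rule nn_integral_cong_AE)
        show "AE y in M. ennreal (?f y powr p) = ennreal (k x y * (f y / u y) powr p)"
          using u_pos AE_space
        proof eventually_elim
          case y: (elim y)
          then show ?case
            using k0[OF elim(3) y(2)] f0[of y] pq
            by (simp add: powr_mult powr_powr p1 del: times_divide_eq_right times_divide_eq_left)
        qed
      qed
      then show "(\<integral>\<^sup>+y. ennreal (?f y powr p) \<partial>M) \<le> ennreal (enn2real (H x))"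
        using elim(1) by (simp add: less_top)
      have "(\<integral>\<^sup>+y. ennreal (?g y powr q) \<partial>M) = (\<integral>\<^sup>+y. ennreal (k x y * u y powr q) \<partial>M)"
      proof (rule nn_integral_cong_AE)
        show "AE y in M. ennreal (?g y powr q) = ennreal (k x y * u y powr q)"
          using u_pos AE_space
        proof eventually_elim
          case y: (elim y)
          then show ?case
            using k0[OF elim(3) y(2)] pq by (simp add: powr_mult powr_powr)
        qed
      qed
      then show "(\<integral>\<^sup>+y. ennreal (?g y powr q) \<partial>M) \<le> ennreal (c * u x powr q)"
        using elim(2) by simp
    qed (use c in auto)
    finally show ?case .
  qed
  then show ?fin by eventually_elim (auto elim!: le_less_trans)
  have "(\<integral>\<^sup>+x. ennreal (enn2real (\<integral>\<^sup>+y. ennreal (k x y * f y) \<partial>M) powr p) \<partial>M)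
      \<le> (\<integral>\<^sup>+x. ennreal (c powr (p / q)) * (H x * ennreal (u x powr p)) \<partial>M)"
  proof (rule nn_integral_mono_AE)
    show "AE x in M. ennreal (enn2real (\<integral>\<^sup>+y. ennreal (k x y * f y) \<partial>M) powr p)
        \<le> ennreal (c powr (p / q)) * (H x * ennreal (u x powr p))"
      using key H_fin u_pos
    proof eventually_elim
      case (elim x)
      have "enn2real (\<integral>\<^sup>+y. ennreal (k x y * f y) \<partial>M) \<le> enn2real (H x) powr (1 / p) * (c * u x powr q) powr (1 / q)"
        using elim(1) by (intro enn2real_leI) auto
      then have "enn2real (\<integral>\<^sup>+y. ennreal (k x y * f y) \<partial>M) powr p
          \<le> (enn2real (H x) powr (1 / p) * (c * u x powr q) powr (1 / q)) powr p"
        using pq by (intro powr_mono2) auto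
      also have "\<dots> = c powr (p / q) * (enn2real (H x) * u x powr p)"
        using pq c elim(3) by (simp add: powr_mult powr_powr)
      finally have "ennreal (enn2real (\<integral>\<^sup>+y. ennreal (k x y * f y) \<partial>M) powr p)
          \<le> ennreal (c powr (p / q)) * (ennreal (enn2real (H x)) * ennreal (u x powr p))"
        by (simp add: ennreal_mult[symmetric] ennreal_leI)
      then show ?case using elim(2) by (simp add: less_top)
    qed
  qed
  also have "\<dots> = ennreal (c powr (p / q)) * (\<integral>\<^sup>+x. H x * ennreal (u x powr p) \<partial>M)"
    by (rule nn_integral_cmult) measurable
  also have "\<dots> \<le> ennreal (c powr (p / q)) * (ennreal c * (\<integral>\<^sup>+x. ennreal (f x powr p) \<partial>M))"
    by (rule mult_left_mono[OF Hu]) simp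
  also have "\<dots> = ennreal (c powr (p / q) * c) * (\<integral>\<^sup>+x. ennreal (f x powr p) \<partial>M)"
    using c by (simp add: ennreal_mult mult.assoc)
  also have "c powr (p / q) * c = c powr p"
  proof -
    have "1 / q = 1 - 1 / p" using pq(3) by linarith
    then have "p * (1 / q) = p * (1 - 1 / p)" by (rule arg_cong)
    then have e: "p / q = p - 1" using pq(1) by (simp add: right_diff_distrib)
    show ?thesis
      unfolding e using c pq by (cases "c = 0") (simp_all add: powr_diff)
  qed
  finally show ?le .
qed

section \<open>$L^p$ norms and completed measures\<close>

text \<open>
  Estimates of norms become estimates of integrals of $p$-th powers, which avoids roots of extended reals.
\<close>

lemma Lp_norm_le_iff:
  assumes "0 < p" "0 \<le> r"
  shows "Lp_norm p M f \<le> ennreal r \<longleftrightarrow> (\<integral>\<^sup>+x. ennreal (norm (f x) powr p) \<partial>M) \<le> ennreal (r powr p)"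
proof (cases "(\<integral>\<^sup>+x. ennreal (norm (f x) powr p) \<partial>M)")
  case (real a)
  have "a powr (1 / p) \<le> r \<longleftrightarrow> a \<le> r powr p"
  proof
    assume "a powr (1 / p) \<le> r"
    then have "(a powr (1 / p)) powr p \<le> r powr p" using assms by (intro powr_mono2) auto
    then show "a \<le> r powr p" using assms real by (simp add: powr_powr)
  next
    assume "a \<le> r powr p"
    then have "a powr (1 / p) \<le> (r powr p) powr (1 / p)" using assms real by (intro powr_mono2) auto
    then show "a powr (1 / p) \<le> r" using assms by (simp add: powr_powr)
  qed
  then show ?thesis using real assms by (simp add: Lp_norm_def Let_def ennreal_le_iff)
next
  case top
  then show ?thesis by (simp add: Lp_norm_def Let_def top_unique)
qed

lemma Lp_norm_finite_iff:
  "Lp_norm p M f < \<infinity> \<longleftrightarrow> (\<integral>\<^sup>+x. ennreal (norm (f x) powr p) \<partial>M) < \<infinity>"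
  by (auto simp: Lp_norm_def Let_def less_top)

text \<open>
  Each simple function in an approximating sequence agrees almost everywhere with a Borel simple function;
  the limit of the latter is the representative.
\<close>

lemma completion_borel_representative:
  fixes f :: "'a \<Rightarrow> 'b::{second_countable_topology, banach}"
  assumes f: "f \<in> borel_measurable (completion M)"
  shows "\<exists>g \<in> borel_measurable M. AE x in M. f x = g x"
proof -
  obtain s where s: "\<And>i. simple_function (completion M) (s i)"
      "\<And>x. x \<in> space (completion M) \<Longrightarrow> (\<lambda>i. s i x) \<longlonglongrightarrow> f x"
    using borel_measurable_implies_sequence_metric[OF f, of 0] by blast
  have "\<forall>i. \<exists>s'. simple_function M s' \<and> (AE x in M. s i x = s' x)"
    using completion_ex_simple_function[OF s(1)] by blast
  then obtain s' where s': "\<And>i. simple_function M (s' i)" "\<And>i. AE x in M. s i x = s' i x"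
    by metis
  have m: "s' i \<in> borel_measurable M" for i by (rule borel_measurable_simple_function[OF s'(1)])
  define g where "g x = lim (\<lambda>i. s' i x)" for x
  have "g \<in> borel_measurable M"
    unfolding g_def[abs_def] by (rule borel_measurable_lim_metric[OF m])
  moreover have "AE x in M. f x = g x"
  proof -
    have "AE x in M. \<forall>i. s i x = s' i x" using s'(2) by (simp add: AE_all_countable)
    with AE_space show ?thesis
    proof eventually_elim
      case (elim x)
      then have "(\<lambda>i. s' i x) \<longlonglongrightarrow> f x" using s(2)[of x] by simp
      then show ?case by (simp add: g_def limI)
    qed
  qed
  ultimately show ?thesis by blast
qed

section \<open>Products of kernels\<close>

lemma prod_mono_ennreal:
  fixes f g :: "'a \<Rightarrow> ennreal"
  shows "(\<And>i. i \<in> A \<Longrightarrow> f i \<le> g i) \<Longrightarrow> prod f A \<le> prod g A"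
  by (induction A rule: infinite_finite_induct) (auto intro!: mult_mono)

lemma ennreal_scaled_prod_powr:
  fixes b :: "'a \<Rightarrow> real"
  assumes "\<And>i. i \<in> A \<Longrightarrow> 0 \<le> b i" "0 \<le> s"
  shows "ennreal ((s * (\<Prod>i\<in>A. b i)) powr p) = ennreal (s powr p) * (\<Prod>i\<in>A. ennreal (b i powr p))"
  using assms by (simp add: powr_mult prod_powr_distrib ennreal_mult prod_ennreal prod_nonneg)

lemma prod_ennreal_mult: "(\<And>i. i \<in> A \<Longrightarrow> 0 \<le> f i) \<Longrightarrow> (\<And>i. i \<in> A \<Longrightarrow> 0 \<le> g i) \<Longrightarrow>
    ennreal ((\<Prod>i\<in>A. f i) * (\<Prod>i\<in>A. g i)) = (\<Prod>i\<in>A. ennreal (f i) * ennreal (g i))"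
  by (simp add: prod.distrib[symmetric] prod_ennreal[symmetric] ennreal_mult)

interpretation Leb_prod: product_sigma_finite "\<lambda>i. Leb (n i)" for n :: "nat \<Rightarrow> nat"
  by (simp add: product_sigma_finite_def sigma_finite_Leb)

text \<open>
  Stated for kernels that depend on the dimension only, as in the theorem.  The hypotheses are symmetric
  under transposition combined with passage to the conjugate exponent.
\<close>

locale kernel_family =
  fixes p :: real and m :: nat and n :: "nat \<Rightarrow> nat"
    and K :: "nat \<Rightarrow> (nat \<Rightarrow> real) \<Rightarrow> (nat \<Rightarrow> real) \<Rightarrow> real"
  assumes p: "1 < p"
    and kernel: "\<And>i. i \<in> {1..m} \<Longrightarrow> homogeneous_kernel (n i) (K (n i))"
begin

abbreviation P :: "(nat \<Rightarrow> nat \<Rightarrow> real) measure" where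
  "P \<equiv> \<Pi>\<^sub>M i\<in>{1..m}. Leb (n i)"

abbreviation k :: "(nat \<Rightarrow> nat \<Rightarrow> real) \<Rightarrow> (nat \<Rightarrow> nat \<Rightarrow> real) \<Rightarrow> real" where
  "k \<equiv> prod_kernel m n K"

definition q :: real where "q = p / (p - 1)"

definition \<kappa> :: "nat \<Rightarrow> real" where
  "\<kappa> i = enn2real (homogeneous_kernel.moment (n i) (K (n i)) (\<lambda>r. ennreal (r powr - (real (n i) / p))))"

definition \<kappa>_trunc :: "nat \<Rightarrow> nat \<Rightarrow> real" where
  "\<kappa>_trunc L i = enn2real (homogeneous_kernel.moment (n i) (K (n i))
     (\<lambda>r. ennreal (r powr - (real (n i) / p)) * annulus (- int L) (int L) r))"

lemma q: "1 < q" "1 / p + 1 / q = 1"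
  using p by (auto simp: q_def field_simps)

lemma sigma_finite_P: "sigma_finite_measure P"
  by (rule Leb_prod.sigma_finite) simp

lemma leb_eq: "leb m n = completion P"
  by (simp add: leb_def)

lemma component_in_Rn: "x \<in> space P \<Longrightarrow> i \<in> {1..m} \<Longrightarrow> x i \<in> Rn (n i)"
  using PiE_mem[of x "{1..m}" "\<lambda>i. space (Leb (n i))" i] unfolding space_PiM[of "{1..m}"] space_Leb by simp

lemma AE_component_norm_pos: "AE x in P. \<forall>i\<in>{1..m}. 0 < eucl_norm (n i) (x i)"
  by (intro AE_finite_allI Leb_prod.AE_PiM_component AE_Leb_eucl_norm_pos homogeneous_kernel.dim[OF kernel]) auto

lemma k_measurable: "(\<lambda>(x, y). k x y) \<in> borel_measurable (P \<Otimes>\<^sub>M P)"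
  unfolding prod_kernel_def case_prod_beta'
proof (rule borel_measurable_prod)
  fix i assume i: "i \<in> {1..m}"
  have c: "(\<lambda>x. x i) \<in> P \<rightarrow>\<^sub>M Leb (n i)" by (rule measurable_component_singleton[OF i])
  show "(\<lambda>z. K (n i) (fst z i) (snd z i)) \<in> borel_measurable (P \<Otimes>\<^sub>M P)"
    by (rule homogeneous_kernel.kernel_measurable'[OF kernel[OF i]])
      (rule measurable_compose[OF measurable_fst c] measurable_compose[OF measurable_snd c])+
qed

lemma k_nonneg: "x \<in> space P \<Longrightarrow> y \<in> space P \<Longrightarrow> 0 \<le> k x y"
  unfolding prod_kernel_def
  by (intro prod_nonneg homogeneous_kernel.nonneg[OF kernel] component_in_Rn ballI) auto

lemma nn_integral_P_prod:
  assumes "\<And>i. i \<in> {1..m} \<Longrightarrow> h i \<in> borel_measurable (Leb (n i))"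
  shows "(\<integral>\<^sup>+y. (\<Prod>i\<in>{1..m}. h i (y i)) \<partial>P) = (\<Prod>i\<in>{1..m}. \<integral>\<^sup>+y. h i y \<partial>Leb (n i))"
  by (rule Leb_prod.product_nn_integral_prod) (use assms in auto)

lemma exponent: "i \<in> {1..m} \<Longrightarrow> 0 < real (n i) / p" "i \<in> {1..m} \<Longrightarrow> real (n i) / p < real (n i)"
    "real (n i) - real (n i) / p = real (n i) / q"
proof -
  show "0 < real (n i) / p" "real (n i) / p < real (n i)" if "i \<in> {1..m}"
    using homogeneous_kernel.dim[OF kernel[OF that]] p by (auto simp: field_simps)
  have "1 / q = 1 - 1 / p" using q(2) by linarith
  then have "real (n i) * (1 / q) = real (n i) * (1 - 1 / p)" by (rule arg_cong)
  then show "real (n i) - real (n i) / p = real (n i) / q" by (simp add: right_diff_distrib)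
qed

text \<open>
  The second equation, on the transposed kernel, is where the equality of the two eigenvalues enters.
\<close>

lemma moment_eq:
  assumes "i \<in> {1..m}"
  shows "homogeneous_kernel.moment (n i) (K (n i)) (\<lambda>r. ennreal (r powr - (real (n i) / p))) = ennreal (\<kappa> i)"
    and "homogeneous_kernel.moment (n i) (\<lambda>u v. K (n i) v u) (\<lambda>r. ennreal (r powr - (real (n i) / q))) = ennreal (\<kappa> i)"
proof -
  interpret homogeneous_kernel "n i" "K (n i)" by (rule kernel[OF assms])
  show 1: "moment (\<lambda>r. ennreal (r powr - (real (n i) / p))) = ennreal (\<kappa> i)"
    using moment_powr_finite[of "real (n i) / p"] exponent(1,2)[OF assms] by (simp add: \<kappa>_def less_top)
  show "homogeneous_kernel.moment (n i) (\<lambda>u v. K (n i) v u) (\<lambda>r. ennreal (r powr - (real (n i) / q))) = ennreal (\<kappa> i)"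
    using moment_transpose[of "real (n i) / p"] unfolding exponent(3) 1 .
qed

lemma \<kappa>_nonneg [simp]: "0 \<le> \<kappa> i" "0 \<le> \<kappa>_trunc L i"
  by (auto simp: \<kappa>_def \<kappa>_trunc_def)

lemma nn_integral_k_prod:
  assumes x: "\<And>i. i \<in> {1..m} \<Longrightarrow> x i \<in> Rn (n i)"
    and h[measurable]: "\<And>i. i \<in> {1..m} \<Longrightarrow> h i \<in> borel_measurable (Leb (n i))"
    and h0: "\<And>i u. 0 \<le> h i u"
  shows "(\<integral>\<^sup>+y. ennreal (k x y * (\<Prod>i\<in>{1..m}. h i (y i))) \<partial>P)
    = (\<Prod>i\<in>{1..m}. \<integral>\<^sup>+y. ennreal (K (n i) (x i) y) * ennreal (h i y) \<partial>Leb (n i))"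
proof -
  have "(\<integral>\<^sup>+y. ennreal (k x y * (\<Prod>i\<in>{1..m}. h i (y i))) \<partial>P)
      = (\<integral>\<^sup>+y. (\<Prod>i\<in>{1..m}. ennreal (K (n i) (x i) (y i)) * ennreal (h i (y i))) \<partial>P)"
    unfolding prod_kernel_def
    by (intro nn_integral_cong prod_ennreal_mult h0 homogeneous_kernel.nonneg[OF kernel] component_in_Rn x)
  also have "\<dots> = (\<Prod>i\<in>{1..m}. \<integral>\<^sup>+y. ennreal (K (n i) (x i) y) * ennreal (h i y) \<partial>Leb (n i))"
  proof (rule nn_integral_P_prod[where h = "\<lambda>i y. ennreal (K (n i) (x i) y) * ennreal (h i y)"])
    fix i assume i: "i \<in> {1..m}"
    have "(\<lambda>y. K (n i) (x i) y) \<in> borel_measurable (Leb (n i))"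
      by (rule homogeneous_kernel.kernel_measurable'[OF kernel[OF i]]) (use x[OF i] in \<open>auto simp: space_Leb\<close>)
    with h[OF i] show "(\<lambda>y. ennreal (K (n i) (x i) y) * ennreal (h i y)) \<in> borel_measurable (Leb (n i))"
      by measurable
  qed
  finally show ?thesis .
qed

lemma C_const_eq: "C_const p m n K = ennreal (\<Prod>i\<in>{1..m}. \<kappa> i)"
proof -
  let ?e = "\<lambda>i\<in>{1..m}. first_unit (n i)"
  have "C_const p m n K = (\<integral>\<^sup>+y. ennreal (k ?e y * (\<Prod>i\<in>{1..m}. eucl_norm (n i) (y i) powr - (real (n i) / p))) \<partial>P)"
    by (simp add: C_const_def leb_eq nn_integral_completion)
  also have "\<dots> = (\<Prod>i\<in>{1..m}. \<integral>\<^sup>+y. ennreal (K (n i) (?e i) y) * ennreal (eucl_norm (n i) y powr - (real (n i) / p)) \<partial>Leb (n i))"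
    by (rule nn_integral_k_prod) auto
  also have "\<dots> = (\<Prod>i\<in>{1..m}. ennreal (\<kappa> i))"
    by (rule prod.cong) (simp_all add: moment_eq(1)[symmetric] homogeneous_kernel.moment_def[OF kernel])
  finally show ?thesis by (simp add: prod_ennreal)
qed

text \<open>
  Its powers with exponents $q$ and $p$ are the eigenfunctions of the product operator and of its adjoint.
\<close>

definition weight :: "(nat \<Rightarrow> nat \<Rightarrow> real) \<Rightarrow> real" where
  "weight x = (\<Prod>i\<in>{1..m}. eucl_norm (n i) (x i) powr - (real (n i) / (p * q)))"

lemma component_measurable: "i \<in> {1..m} \<Longrightarrow> (\<lambda>x. eucl_norm (n i) (x i)) \<in> borel_measurable P"
  by (rule measurable_compose[OF measurable_component_singleton[of i "{1..m}" "\<lambda>i. Leb (n i)"] eucl_norm_measurable])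

lemma weight_measurable: "weight \<in> borel_measurable P"
  unfolding weight_def[abs_def]
  by (intro borel_measurable_prod powr_real_measurable component_measurable) auto

lemma weight_pos: "(\<forall>i\<in>{1..m}. 0 < eucl_norm (n i) (x i)) \<Longrightarrow> 0 < weight x"
  unfolding weight_def by (intro prod_pos) (auto dest!: bspec)

lemma weight_powr:
  "weight x powr q = (\<Prod>i\<in>{1..m}. eucl_norm (n i) (x i) powr - (real (n i) / p))"
  "weight x powr p = (\<Prod>i\<in>{1..m}. eucl_norm (n i) (x i) powr - (real (n i) / q))"
  using p q(1) by (simp_all add: weight_def prod_powr_distrib powr_powr)

lemma row_integral:
  assumes x: "x \<in> space P" "\<forall>i\<in>{1..m}. 0 < eucl_norm (n i) (x i)"
  shows "(\<integral>\<^sup>+y. ennreal (k x y * weight y powr q) \<partial>P) = ennreal ((\<Prod>i\<in>{1..m}. \<kappa> i) * weight x powr q)"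
proof -
  have "(\<integral>\<^sup>+y. ennreal (k x y * weight y powr q) \<partial>P)
      = (\<Prod>i\<in>{1..m}. \<integral>\<^sup>+y. ennreal (K (n i) (x i) y) * ennreal (eucl_norm (n i) y powr - (real (n i) / p)) \<partial>Leb (n i))"
    unfolding weight_powr by (rule nn_integral_k_prod) (use x component_in_Rn in auto)
  also have "\<dots> = (\<Prod>i\<in>{1..m}. ennreal (\<kappa> i) * ennreal (eucl_norm (n i) (x i) powr - (real (n i) / p)))"
    using x component_in_Rn
    by (intro prod.cong refl)
      (simp add: homogeneous_kernel.nn_integral_kernel_powr[OF kernel] moment_eq mult.commute)
  also have "\<dots> = ennreal ((\<Prod>i\<in>{1..m}. \<kappa> i) * weight x powr q)"
    unfolding weight_powr by (rule prod_ennreal_mult[symmetric]) auto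
  finally show ?thesis .
qed

lemma q_over: "q / (q - 1) = p"
  using p by (simp add: q_def field_simps)

lemma transpose_family: "kernel_family q m n (\<lambda>d u v. K d v u)"
  by (intro kernel_family.intro homogeneous_kernel.transpose[OF kernel] q(1))

text \<open>
  This is the row identity for the transposed kernels with $p$ and $q$ exchanged.
\<close>

lemma column_integral:
  assumes y: "y \<in> space P" "\<forall>i\<in>{1..m}. 0 < eucl_norm (n i) (y i)"
  shows "(\<integral>\<^sup>+x. ennreal (k x y * weight x powr p) \<partial>P) = ennreal ((\<Prod>i\<in>{1..m}. \<kappa> i) * weight y powr p)"
proof -
  interpret T: kernel_family q m n "\<lambda>d u v. K d v u" by (rule transpose_family)
  have Tq: "T.q = p" by (simp add: T.q_def q_over)
  have Tw: "T.weight = weight" by (simp add: fun_eq_iff T.weight_def weight_def Tq mult.commute)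
  have T\<kappa>: "T.\<kappa> i = \<kappa> i" if "i \<in> {1..m}" for i
    using T.moment_eq(1)[OF that] moment_eq(2)[OF that] by simp
  have "(\<integral>\<^sup>+x. ennreal (prod_kernel m n (\<lambda>d u v. K d v u) y x * T.weight x powr T.q) \<partial>P)
      = ennreal ((\<Prod>i\<in>{1..m}. T.\<kappa> i) * T.weight y powr T.q)"
    by (rule T.row_integral[OF y])
  also have "(\<Prod>i\<in>{1..m}. T.\<kappa> i) = (\<Prod>i\<in>{1..m}. \<kappa> i)"
    by (rule prod.cong) (auto simp: T\<kappa>)
  finally show ?thesis by (simp add: Tw Tq prod_kernel_def)
qed

lemma upper_bound_real:
  fixes f :: "(nat \<Rightarrow> nat \<Rightarrow> real) \<Rightarrow> real"
  assumes f: "f \<in> borel_measurable P" "\<And>x. 0 \<le> f x" "(\<integral>\<^sup>+x. ennreal (f x powr p) \<partial>P) < \<infinity>"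
  shows "AE x in P. (\<integral>\<^sup>+y. ennreal (k x y * f y) \<partial>P) < \<infinity>"
    and "(\<integral>\<^sup>+x. ennreal (enn2real (\<integral>\<^sup>+y. ennreal (k x y * f y) \<partial>P) powr p) \<partial>P)
      \<le> ennreal ((\<Prod>i\<in>{1..m}. \<kappa> i) powr p) * (\<integral>\<^sup>+x. ennreal (f x powr p) \<partial>P)"
proof -
  interpret sigma_finite_measure P by (rule sigma_finite_P)
  have pos: "AE x in P. 0 < weight x"
    using AE_component_norm_pos by eventually_elim (rule weight_pos)
  have row: "AE x in P. (\<integral>\<^sup>+y. ennreal (k x y * weight y powr q) \<partial>P) \<le> ennreal ((\<Prod>i\<in>{1..m}. \<kappa> i) * weight x powr q)"
    using AE_component_norm_pos AE_space by eventually_elim (rule eq_refl[OF row_integral])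
  have column: "AE y in P. (\<integral>\<^sup>+x. ennreal (k x y * weight x powr p) \<partial>P) \<le> ennreal ((\<Prod>i\<in>{1..m}. \<kappa> i) * weight y powr p)"
    using AE_component_norm_pos AE_space by eventually_elim (rule eq_refl[OF column_integral])
  have c: "0 \<le> (\<Prod>i\<in>{1..m}. \<kappa> i)" by (intro prod_nonneg) auto
  note S = Schur_test[OF k_measurable k_nonneg weight_measurable pos p q c row column f]
  show "AE x in P. (\<integral>\<^sup>+y. ennreal (k x y * f y) \<partial>P) < \<infinity>" by (rule S(1))
  show "(\<integral>\<^sup>+x. ennreal (enn2real (\<integral>\<^sup>+y. ennreal (k x y * f y) \<partial>P) powr p) \<partial>P)
      \<le> ennreal ((\<Prod>i\<in>{1..m}. \<kappa> i) powr p) * (\<integral>\<^sup>+x. ennreal (f x powr p) \<partial>P)" by (rule S(2))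
qed

section \<open>The upper bound\<close>

lemma component_compose_measurable:
  "i \<in> {1..m} \<Longrightarrow> h \<in> borel_measurable (Leb (n i)) \<Longrightarrow> (\<lambda>x. h (x i)) \<in> borel_measurable P"
  by (rule measurable_compose[OF measurable_component_singleton[of i "{1..m}" "\<lambda>i. Leb (n i)"]])

lemma k_measurable_right: "x \<in> space P \<Longrightarrow> (\<lambda>y. k x y) \<in> borel_measurable P"
  using measurable_Pair2[OF k_measurable] by simp

abbreviation C :: real where "C \<equiv> \<Prod>i\<in>{1..m}. \<kappa> i"

lemma C_nonneg: "0 \<le> C"
  by (intro prod_nonneg) auto

text \<open>
  The function is replaced by a Borel representative, since Tonelli's theorem, which enters through the Schur
  test, requires measurability for the product measure and not merely for its completion.
\<close>

lemma T_op_bound: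
  fixes f :: "(nat \<Rightarrow> nat \<Rightarrow> real) \<Rightarrow> 'b::{real_normed_field, banach, second_countable_topology}"
  assumes f: "f \<in> Lp p (leb m n)"
  shows "AE x in leb m n. integrable (leb m n) (\<lambda>y. k x y *\<^sub>R f y)" (is ?int)
    and "T_op m n K f \<in> borel_measurable (leb m n)" (is ?meas)
    and "(\<integral>\<^sup>+x. ennreal (norm (T_op m n K f x) powr p) \<partial>leb m n)
      \<le> ennreal (C powr p) * (\<integral>\<^sup>+x. ennreal (norm (f x) powr p) \<partial>leb m n)" (is ?le)
proof -
  have fm: "f \<in> borel_measurable (completion P)" and fp: "(\<integral>\<^sup>+x. ennreal (norm (f x) powr p) \<partial>P) < \<infinity>"
    using f by (simp_all add: Lp_def Lp_norm_finite_iff[unfolded infinity_ennreal_def] leb_eq nn_integral_completion)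
  obtain g where g[measurable]: "g \<in> borel_measurable P" and fg: "AE x in P. f x = g x"
    using completion_borel_representative[OF fm] by blast
  have norms: "(\<integral>\<^sup>+x. ennreal (norm (g x) powr p) \<partial>P) = (\<integral>\<^sup>+x. ennreal (norm (f x) powr p) \<partial>P)"
    by (rule nn_integral_cong_AE) (use fg in eventually_elim, simp)
  have gm: "(\<lambda>x. norm (g x)) \<in> borel_measurable P" by measurable
  note U = upper_bound_real[OF gm norm_ge_zero, unfolded norms, OF fp]
  have kgm: "(\<lambda>y. k x y *\<^sub>R g y) \<in> borel_measurable P" if "x \<in> space P" for x
    using k_measurable_right[OF that] by measurable
  have kfm: "(\<lambda>y. k x y *\<^sub>R f y) \<in> borel_measurable (completion P)" if "x \<in> space P" for x
    using measurable_completion[OF k_measurable_right[OF that]] fm by measurable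
  have kfg: "AE y in completion P. k x y *\<^sub>R f y = k x y *\<^sub>R g y" for x
    by (rule AE_completion) (use fg in eventually_elim, simp)
  have Tg: "T_op m n K f x = (LINT y|P. k x y *\<^sub>R g y)" if x: "x \<in> space P" for x
  proof -
    have "T_op m n K f x = (LINT y|completion P. k x y *\<^sub>R g y)"
      unfolding T_op_def leb_eq
      by (rule integral_cong_AE[OF kfm[OF x] measurable_completion[OF kgm[OF x]] kfg])
    then show ?thesis unfolding integral_completion[OF kgm[OF x]] .
  qed
  have int_g: "AE x in P. x \<in> space P \<and> integrable P (\<lambda>y. k x y *\<^sub>R g y)"
    using U(1) AE_space
  proof eventually_elim
    case (elim x)
    have "(\<integral>\<^sup>+y. ennreal (norm (k x y *\<^sub>R g y)) \<partial>P) = (\<integral>\<^sup>+y. ennreal (k x y * norm (g y)) \<partial>P)"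
      using elim(2) by (intro nn_integral_cong) (simp add: k_nonneg)
    with elim(1) have "(\<integral>\<^sup>+y. ennreal (norm (k x y *\<^sub>R g y)) \<partial>P) < \<infinity>" by (simp only:)
    then show ?case using integrableI_bounded[OF kgm[OF elim(2)]] elim(2) by blast
  qed
  have "AE x in P. integrable (completion P) (\<lambda>y. k x y *\<^sub>R f y)"
    using int_g
  proof eventually_elim
    case (elim x)
    then have "integrable (completion P) (\<lambda>y. k x y *\<^sub>R g y)"
      by (subst integrable_completion) (auto intro: kgm)
    then show ?case
      using elim integrable_cong_AE[OF kfm measurable_completion[OF kgm] kfg] by blast
  qed
  then show ?int unfolding leb_eq by (rule AE_completion)
  interpret sigma_finite_measure P by (rule sigma_finite_P)
  have "(\<lambda>x. LINT y|P. k x y *\<^sub>R g y) \<in> borel_measurable P"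
  proof (rule borel_measurable_lebesgue_integral)
    note [measurable] = k_measurable
    show "(\<lambda>(x, y). k x y *\<^sub>R g y) \<in> borel_measurable (P \<Otimes>\<^sub>M P)" by measurable
  qed
  then have "T_op m n K f \<in> borel_measurable P"
    by (subst measurable_cong[OF Tg])
  then show ?meas unfolding leb_eq by (rule measurable_completion)
  have "(\<integral>\<^sup>+x. ennreal (norm (T_op m n K f x) powr p) \<partial>P)
      \<le> (\<integral>\<^sup>+x. ennreal (enn2real (\<integral>\<^sup>+y. ennreal (k x y * norm (g y)) \<partial>P) powr p) \<partial>P)"
  proof (rule nn_integral_mono_AE)
    show "AE x in P. ennreal (norm (T_op m n K f x) powr p)
        \<le> ennreal (enn2real (\<integral>\<^sup>+y. ennreal (k x y * norm (g y)) \<partial>P) powr p)"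
      using int_g U(1)
    proof eventually_elim
      case (elim x)
      then have x: "x \<in> space P" by simp
      have "ennreal (norm (T_op m n K f x)) \<le> (\<integral>\<^sup>+y. ennreal (norm (k x y *\<^sub>R g y)) \<partial>P)"
        unfolding Tg[OF x] using elim by (intro integral_norm_bound_ennreal) auto
      also have "\<dots> = (\<integral>\<^sup>+y. ennreal (k x y * norm (g y)) \<partial>P)"
        using x by (intro nn_integral_cong) (simp add: k_nonneg)
      also have "\<dots> = ennreal (enn2real (\<integral>\<^sup>+y. ennreal (k x y * norm (g y)) \<partial>P))"
        using elim(2) by (simp add: less_top)
      finally have "norm (T_op m n K f x) \<le> enn2real (\<integral>\<^sup>+y. ennreal (k x y * norm (g y)) \<partial>P)"
        by (simp add: ennreal_le_iff)
      then show ?case using p by (intro ennreal_leI powr_mono2) auto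
    qed
  qed
  also note U(2)
  finally show ?le by (simp add: leb_eq nn_integral_completion)
qed

lemma T_op_Lp:
  fixes f :: "(nat \<Rightarrow> nat \<Rightarrow> real) \<Rightarrow> 'b::{real_normed_field, banach, second_countable_topology}"
  assumes f: "f \<in> Lp p (leb m n)"
  shows "T_op m n K f \<in> Lp p (leb m n)"
    and "Lp_norm p (leb m n) (T_op m n K f) \<le> ennreal C * Lp_norm p (leb m n) f"
proof -
  have "(\<integral>\<^sup>+x. ennreal (norm (f x) powr p) \<partial>leb m n) < \<infinity>"
    using f by (simp add: Lp_def Lp_norm_finite_iff[unfolded infinity_ennreal_def])
  then obtain a where a: "0 \<le> a" "(\<integral>\<^sup>+x. ennreal (norm (f x) powr p) \<partial>leb m n) = ennreal a"
    by (cases "\<integral>\<^sup>+x. ennreal (norm (f x) powr p) \<partial>leb m n") auto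
  have "(\<integral>\<^sup>+x. ennreal (norm (T_op m n K f x) powr p) \<partial>leb m n) \<le> ennreal (C powr p) * ennreal a"
    using T_op_bound(3)[OF f] a by simp
  also have "\<dots> = ennreal ((C * a powr (1 / p)) powr p)"
    using a C_nonneg p by (simp add: ennreal_mult powr_mult powr_powr)
  finally have le: "Lp_norm p (leb m n) (T_op m n K f) \<le> ennreal (C * a powr (1 / p))"
    using p C_nonneg by (subst Lp_norm_le_iff) auto
  have "Lp_norm p (leb m n) f = ennreal (a powr (1 / p))"
    using a by (simp add: Lp_norm_def Let_def)
  with le show "Lp_norm p (leb m n) (T_op m n K f) \<le> ennreal C * Lp_norm p (leb m n) f"
    using C_nonneg by (simp add: ennreal_mult)
  from le have "Lp_norm p (leb m n) (T_op m n K f) < \<infinity>"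
    by (auto elim!: le_less_trans)
  then show "T_op m n K f \<in> Lp p (leb m n)"
    using T_op_bound(2)[OF f] by (simp add: Lp_def)
qed

lemma opnorm_le:
  "Lp_opnorm p (leb m n) (T_op m n K :: ((nat \<Rightarrow> nat \<Rightarrow> real) \<Rightarrow> 'b::{real_normed_field, banach, second_countable_topology}) \<Rightarrow> _)
    \<le> ennreal C"
  unfolding Lp_opnorm_def
proof (rule SUP_least)
  fix f :: "(nat \<Rightarrow> nat \<Rightarrow> real) \<Rightarrow> 'b"
  assume f: "f \<in> {f \<in> Lp p (leb m n). Lp_norm p (leb m n) f \<le> 1}"
  then have "Lp_norm p (leb m n) (T_op m n K f) \<le> ennreal C * Lp_norm p (leb m n) f"
    by (intro T_op_Lp) auto
  also have "\<dots> \<le> ennreal C * 1" using f by (intro mult_left_mono) auto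
  finally show "Lp_norm p (leb m n) (T_op m n K f) \<le> ennreal C" by simp
qed

section \<open>The lower bound\<close>

text \<open>
  The eigenfunction $|u|^{-n_i/p}$ cut off to $2^{-L} \le |u| < 2^{L^2 + L}$.
\<close>

definition profile :: "nat \<Rightarrow> nat \<Rightarrow> (nat \<Rightarrow> real) \<Rightarrow> real" where
  "profile L i u = eucl_norm (n i) u powr - (real (n i) / p) *
     enn2real (annulus (- int L) (int (L * L) + int L) (eucl_norm (n i) u))"

lemma profile_nonneg [simp]: "0 \<le> profile L i u"
  by (simp add: profile_def)

lemma profile_measurable [measurable]: "profile L i \<in> borel_measurable (Leb (n i))"
  unfolding profile_def[abs_def] by measurable

lemma prod_profile_measurable: "(\<lambda>y. \<Prod>i\<in>{1..m}. profile L i (y i)) \<in> borel_measurable P"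
  by (intro borel_measurable_prod component_compose_measurable profile_measurable)

lemma ennreal_profile: "ennreal (profile L i u) = ennreal (eucl_norm (n i) u powr - (real (n i) / p)) *
     annulus (- int L) (int (L * L) + int L) (eucl_norm (n i) u)"
  by (simp add: profile_def ennreal_mult)

definition \<omega> :: "nat \<Rightarrow> real" where "\<omega> i = enn2real (shell_mass (n i))"

lemma \<omega>: "i \<in> {1..m} \<Longrightarrow> 0 < \<omega> i" "shell_mass (n i) = ennreal (\<omega> i)"
  using shell_mass_pos[of "n i"] shell_mass_finite[of "n i"] homogeneous_kernel.dim[OF kernel, of i]
  by (auto simp: \<omega>_def enn2real_positive_iff less_top)

lemma annulus_powr_p:
  "ennreal ((enn2real (annulus a b r) * c) powr p) = annulus a b r * ennreal (c powr p)" 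
  using p by (auto simp: annulus_def indicator_def)

text \<open>
  The support consists of $L^2 + 2L$ dyadic shells, and the $p$-th power of the profile is $|u|^{-n_i}$ there.
\<close>

lemma nn_integral_profile_powr:
  "(\<integral>\<^sup>+u. ennreal (profile L i u powr p) \<partial>Leb (n i)) = ennreal (real (L * L + 2 * L) * \<omega> i)"
proof -
  have "ennreal (profile L i u powr p) = ennreal (eucl_norm (n i) u powr - real (n i)) *
      annulus (- int L) (- int L + int (L * L + 2 * L)) (eucl_norm (n i) u)" for u
  proof -
    have e: "- int L + int (L * L + 2 * L) = int (L * L) + int L" by simp
    show ?thesis
      unfolding e profile_def mult.commute[of "eucl_norm _ _ powr _"] annulus_powr_p
      using p by (simp add: powr_powr mult.commute)
  qed
  then have "(\<integral>\<^sup>+u. ennreal (profile L i u powr p) \<partial>Leb (n i)) = of_nat (L * L + 2 * L) * ennreal (\<omega> i)"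
    by (simp only: nn_integral_annulus \<omega>(2))
  then show ?thesis
    by (simp only: ennreal_of_nat_eq_real_of_nat ennreal_mult'[OF of_nat_0_le_iff])
qed

lemma moment_trunc_eq:
  assumes "i \<in> {1..m}"
  shows "homogeneous_kernel.moment (n i) (K (n i))
     (\<lambda>r. ennreal (r powr - (real (n i) / p)) * annulus (- int L) (int L) r) = ennreal (\<kappa>_trunc L i)"
proof -
  interpret homogeneous_kernel "n i" "K (n i)" by (rule kernel[OF assms])
  have "moment (\<lambda>r. ennreal (r powr - (real (n i) / p)) * annulus (- int L) (int L) r)
      \<le> moment (\<lambda>r. ennreal (r powr - (real (n i) / p)))"
    unfolding moment_def
    by (intro nn_integral_mono mult_left_mono) (auto simp: annulus_def indicator_def)
  also have "\<dots> < \<infinity>" by (simp add: moment_eq(1)[OF assms])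
  finally show ?thesis by (simp add: \<kappa>_trunc_def less_top)
qed

lemma \<kappa>_trunc_tendsto: "i \<in> {1..m} \<Longrightarrow> (\<lambda>L. \<kappa>_trunc L i) \<longlonglongrightarrow> \<kappa> i"
  using homogeneous_kernel.moment_truncated_tendsto[OF kernel, of i "real (n i) / p"]
  by (simp add: moment_trunc_eq moment_eq)

lemma k_profile_ge:
  assumes x: "x \<in> space P" "\<forall>i\<in>{1..m}. 0 < eucl_norm (n i) (x i)"
  shows "ennreal (\<Prod>i\<in>{1..m}. enn2real (annulus 0 (int (L * L)) (eucl_norm (n i) (x i))) *
        (\<kappa>_trunc L i * eucl_norm (n i) (x i) powr - (real (n i) / p)))
    \<le> (\<integral>\<^sup>+y. ennreal (k x y * (\<Prod>i\<in>{1..m}. profile L i (y i))) \<partial>P)"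
proof -
  have "(\<integral>\<^sup>+y. ennreal (k x y * (\<Prod>i\<in>{1..m}. profile L i (y i))) \<partial>P)
      = (\<Prod>i\<in>{1..m}. \<integral>\<^sup>+y. ennreal (K (n i) (x i) y) * ennreal (profile L i y) \<partial>Leb (n i))"
    by (rule nn_integral_k_prod) (use x component_in_Rn in auto)
  moreover have "(\<Prod>i\<in>{1..m}. ennreal (enn2real (annulus 0 (int (L * L)) (eucl_norm (n i) (x i))) *
        (\<kappa>_trunc L i * eucl_norm (n i) (x i) powr - (real (n i) / p))))
      \<le> (\<Prod>i\<in>{1..m}. \<integral>\<^sup>+y. ennreal (K (n i) (x i) y) * ennreal (profile L i y) \<partial>Leb (n i))"
  proof (rule prod_mono_ennreal)
    fix i assume i: "i \<in> {1..m}"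
    have "x i \<in> Rn (n i)" "0 < eucl_norm (n i) (x i)" using x i component_in_Rn by auto
    from homogeneous_kernel.truncated_kernel_powr_ge[OF kernel[OF i] this, of "real (n i) / p" L "L * L"]
    show "ennreal (enn2real (annulus 0 (int (L * L)) (eucl_norm (n i) (x i))) *
        (\<kappa>_trunc L i * eucl_norm (n i) (x i) powr - (real (n i) / p)))
      \<le> (\<integral>\<^sup>+y. ennreal (K (n i) (x i) y) * ennreal (profile L i y) \<partial>Leb (n i))"
      unfolding ennreal_profile moment_trunc_eq[OF i] by (simp add: ennreal_mult ac_simps)
  qed
  ultimately show ?thesis by (simp add: prod_ennreal)
qed

text \<open>
  The test function is the product of the profiles, scaled to norm one.  The $p$-th power of the norm of its
  image is estimated from below by integrating over $1 \le |x_i| < 2^{L^2}$, which consists of $L^2$ shells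
  in each factor.  The quotient of the numbers of shells is $(L^2 + 2L) / L^2 = 1 + 2/L$.
\<close>

lemma opnorm_ge_truncated:
  assumes L: "1 \<le> L" and op: "0 \<le> op"
    "Lp_opnorm p (leb m n) (T_op m n K :: ((nat \<Rightarrow> nat \<Rightarrow> real) \<Rightarrow> 'b::{real_normed_field, banach, second_countable_topology}) \<Rightarrow> _)
    \<le> ennreal op"
  shows "(\<Prod>i\<in>{1..m}. \<kappa>_trunc L i) \<le> op * ((1 + 2 / real L) ^ m) powr (1 / p)"
proof -
  define V where "V = (\<Prod>i\<in>{1..m}. real (L * L + 2 * L) * \<omega> i)"
  have V: "0 < V" unfolding V_def
  proof (intro prod_pos ballI mult_pos_pos)
    show "0 < real (L * L + 2 * L)" using L unfolding of_nat_0_less_iff by simp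
  qed (rule \<omega>(1))
  \<comment> \<open>\<open>V\<close> is the integral of the $p$-th power of the unscaled product of profiles.\<close>
  define s where "s = V powr - (1 / p)"
  have "s powr p = V powr - 1" using p by (simp add: s_def powr_powr)
  then have s: "0 < s" "s powr p * V = 1" using V by (auto simp: s_def powr_minus)
  define t where "t y = s * (\<Prod>i\<in>{1..m}. profile L i (y i))" for y
  have t0: "0 \<le> t y" for y using s by (auto simp: t_def intro!: prod_nonneg mult_nonneg_nonneg)
  have tm[measurable]: "t \<in> borel_measurable P"
    unfolding t_def[abs_def]
    by (intro borel_measurable_times borel_measurable_const prod_profile_measurable)
  have tp: "(\<integral>\<^sup>+y. ennreal (t y powr p) \<partial>P) = 1"
  proof -
    have "ennreal (t y powr p) = ennreal (s powr p) * (\<Prod>i\<in>{1..m}. ennreal (profile L i (y i) powr p))" for y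
      unfolding t_def using s(1) by (intro ennreal_scaled_prod_powr) simp_all
    then have "(\<integral>\<^sup>+y. ennreal (t y powr p) \<partial>P)
        = ennreal (s powr p) * (\<integral>\<^sup>+y. (\<Prod>i\<in>{1..m}. ennreal (profile L i (y i) powr p)) \<partial>P)"
      by (simp only:) (rule nn_integral_cmult, rule borel_measurable_prod_ennreal,
          rule component_compose_measurable[where h = "\<lambda>u. ennreal (profile L i u powr p)" for i], assumption, measurable)
    also have "\<dots> = ennreal (s powr p) * (\<Prod>i\<in>{1..m}. ennreal (real (L * L + 2 * L) * \<omega> i))"
      by (subst nn_integral_P_prod[where h = "\<lambda>i u. ennreal (profile L i u powr p)"])
        (simp_all only: nn_integral_profile_powr, measurable)
    also have "\<dots> = ennreal (s powr p * V)"
    proof -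
      have "(\<Prod>i\<in>{1..m}. ennreal (real (L * L + 2 * L) * \<omega> i)) = ennreal V"
        unfolding V_def by (rule prod_ennreal) (intro mult_nonneg_nonneg of_nat_0_le_iff less_imp_le[OF \<omega>(1)])
      then show ?thesis using V by (simp only: ennreal_mult[OF powr_ge_zero less_imp_le])
    qed
    finally show ?thesis using s by simp
  qed
  define f :: "(nat \<Rightarrow> nat \<Rightarrow> real) \<Rightarrow> 'b" where "f y = of_real (t y)" for y
  have f1: "Lp_norm p (leb m n) f \<le> 1"
    using Lp_norm_le_iff[of p 1 "leb m n" f] p tp by (simp add: f_def leb_eq nn_integral_completion t0)
  have fm: "f \<in> borel_measurable P" unfolding f_def[abs_def] by measurable
  have "f \<in> Lp p (leb m n)"
    using f1 measurable_completion[OF fm] by (auto simp: Lp_def leb_eq elim!: le_less_trans)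
  with f1 have "Lp_norm p (leb m n) (T_op m n K f) \<le> ennreal op"
    by (intro order.trans[OF _ op(2)]) (auto simp: Lp_opnorm_def intro!: SUP_upper)
  then have le: "(\<integral>\<^sup>+x. ennreal (norm (T_op m n K f x) powr p) \<partial>P) \<le> ennreal (op powr p)"
    using op(1) p by (subst (asm) Lp_norm_le_iff) (auto simp: leb_eq nn_integral_completion)
  \<comment> \<open>The $i$-th factor of the lower bound for the $p$-th power of the image.\<close>
  let ?h = "\<lambda>i u. ennreal (\<kappa>_trunc L i powr p) * (ennreal (eucl_norm (n i) u powr - real (n i)) * annulus 0 (0 + int (L * L)) (eucl_norm (n i) u))"
  have hm: "?h i \<in> borel_measurable (Leb (n i))" for i by measurable
  have nn_integral_h: "(\<integral>\<^sup>+u. ?h i u \<partial>Leb (n i)) = ennreal (\<kappa>_trunc L i powr p) * ennreal (real (L * L) * \<omega> i)" for i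
  proof -
    have "(\<integral>\<^sup>+u. ?h i u \<partial>Leb (n i)) = ennreal (\<kappa>_trunc L i powr p) * (of_nat (L * L) * ennreal (\<omega> i))"
      by (subst nn_integral_cmult) (simp_all only: nn_integral_annulus \<omega>(2), measurable)
    then show ?thesis by (simp only: ennreal_of_nat_eq_real_of_nat ennreal_mult'[OF of_nat_0_le_iff])
  qed
  have norm_T: "norm (T_op m n K f x) = enn2real (\<integral>\<^sup>+y. ennreal (k x y * t y) \<partial>P)"
    if x: "x \<in> space P" and fin: "(\<integral>\<^sup>+y. ennreal (k x y * t y) \<partial>P) < \<infinity>" for x
  proof -
    have km: "(\<lambda>y. k x y * t y) \<in> borel_measurable P" using k_measurable_right[OF x] by measurable
    have "AE y in P. 0 \<le> k x y * t y"
      using AE_space by eventually_elim (rule mult_nonneg_nonneg[OF k_nonneg[OF x] t0])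
    then have "integrable P (\<lambda>y. k x y * t y)"
      by (rule integrableI_nonneg[OF km _ fin])
    then have int: "integrable (completion P) (\<lambda>y. k x y * t y)"
      by (subst integrable_completion[OF km])
    have "T_op m n K f x = (LINT y|completion P. of_real (k x y * t y))"
      by (simp add: T_op_def leb_eq f_def scaleR_conv_of_real)
    also have "\<dots> = of_real (LINT y|completion P. k x y * t y)"
      by (rule integral_of_real[OF int])
    also have "(LINT y|completion P. k x y * t y) = (LINT y|P. k x y * t y)"
      by (rule integral_completion[OF km])
    also have "\<dots> = enn2real (\<integral>\<^sup>+y. ennreal (k x y * t y) \<partial>P)"
      by (rule integral_eq_nn_integral[OF km \<open>AE y in P. 0 \<le> k x y * t y\<close>])
    finally show ?thesis by simp
  qed
  have fin: "AE x in P. (\<integral>\<^sup>+y. ennreal (k x y * t y) \<partial>P) < \<infinity>"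
    by (rule upper_bound_real(1)[OF tm t0]) (simp only: tp ennreal_one_less_top infinity_ennreal_def)
  have "ennreal (s powr p) * (\<Prod>i\<in>{1..m}. ennreal (\<kappa>_trunc L i powr p) * ennreal (real (L * L) * \<omega> i))
      = ennreal (s powr p) * (\<integral>\<^sup>+x. (\<Prod>i\<in>{1..m}. ?h i (x i)) \<partial>P)"
    unfolding nn_integral_P_prod[where h = ?h, OF hm] nn_integral_h ..
  also have "\<dots> = (\<integral>\<^sup>+x. ennreal (s powr p) * (\<Prod>i\<in>{1..m}. ?h i (x i)) \<partial>P)"
    by (rule nn_integral_cmult[symmetric], rule borel_measurable_prod_ennreal,
        rule component_compose_measurable[where h = "?h i" for i, OF _ hm])
  also have "\<dots> \<le> (\<integral>\<^sup>+x. ennreal (norm (T_op m n K f x) powr p) \<partial>P)"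
  proof (rule nn_integral_mono_AE)
    show "AE x in P. ennreal (s powr p) * (\<Prod>i\<in>{1..m}. ?h i (x i)) \<le> ennreal (norm (T_op m n K f x) powr p)"
      using fin AE_component_norm_pos AE_space
    proof eventually_elim
      case (elim x)
      let ?r = "\<lambda>i. eucl_norm (n i) (x i)"
      let ?b = "\<lambda>i. enn2real (annulus 0 (int (L * L)) (?r i)) * (\<kappa>_trunc L i * ?r i powr - (real (n i) / p))"
      have b0: "0 \<le> (\<Prod>i\<in>{1..m}. ?b i)" by (intro prod_nonneg) auto
      have "ennreal (s * (\<Prod>i\<in>{1..m}. ?b i)) \<le> ennreal s * (\<integral>\<^sup>+y. ennreal (k x y * (\<Prod>i\<in>{1..m}. profile L i (y i))) \<partial>P)"
        using s b0 k_profile_ge[OF elim(3,2), of L] by (simp add: ennreal_mult mult_left_mono)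
      also have "\<dots> = (\<integral>\<^sup>+y. ennreal s * ennreal (k x y * (\<Prod>i\<in>{1..m}. profile L i (y i))) \<partial>P)"
        by (rule nn_integral_cmult[symmetric], rule measurable_compose[OF _ measurable_ennreal],
            intro borel_measurable_times k_measurable_right elim prod_profile_measurable)
      also have "\<dots> = (\<integral>\<^sup>+y. ennreal (k x y * t y) \<partial>P)"
        using s by (intro nn_integral_cong) (simp add: t_def ennreal_mult'[symmetric] ac_simps)
      also have "\<dots> = ennreal (norm (T_op m n K f x))"
        using elim(1) by (simp add: norm_T[OF elim(3,1)] less_top)
      finally have "s * (\<Prod>i\<in>{1..m}. ?b i) \<le> norm (T_op m n K f x)" by (simp add: ennreal_le_iff)
      then have "(s * (\<Prod>i\<in>{1..m}. ?b i)) powr p \<le> norm (T_op m n K f x) powr p"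
        using p s b0 by (intro powr_mono2) auto
      then have "ennreal ((s * (\<Prod>i\<in>{1..m}. ?b i)) powr p) \<le> ennreal (norm (T_op m n K f x) powr p)"
        by (rule ennreal_leI)
      moreover have "ennreal ((s * (\<Prod>i\<in>{1..m}. ?b i)) powr p) = ennreal (s powr p) * (\<Prod>i\<in>{1..m}. ennreal (?b i powr p))"
        using s(1) by (intro ennreal_scaled_prod_powr) simp_all
      moreover have "ennreal (?b i powr p) = ?h i (x i)" for i
        unfolding annulus_powr_p using p by (simp add: powr_mult powr_powr ennreal_mult ac_simps)
      ultimately show ?case by (simp only:)
    qed
  qed
  also note le
  also have "ennreal (s powr p) * (\<Prod>i\<in>{1..m}. ennreal (\<kappa>_trunc L i powr p) * ennreal (real (L * L) * \<omega> i))
      = ennreal (s powr p * (\<Prod>i\<in>{1..m}. \<kappa>_trunc L i powr p * (real (L * L) * \<omega> i)))"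
  proof -
    have nn: "0 \<le> real (L * L) * \<omega> i" if "i \<in> {1..m}" for i
      by (intro mult_nonneg_nonneg of_nat_0_le_iff less_imp_le[OF \<omega>(1)[OF that]])
    have "(\<Prod>i\<in>{1..m}. ennreal (\<kappa>_trunc L i powr p) * ennreal (real (L * L) * \<omega> i))
        = (\<Prod>i\<in>{1..m}. ennreal (\<kappa>_trunc L i powr p * (real (L * L) * \<omega> i)))"
      by (rule prod.cong) (use nn in \<open>simp_all only: ennreal_mult[OF powr_ge_zero]\<close>)
    also have "\<dots> = ennreal (\<Prod>i\<in>{1..m}. \<kappa>_trunc L i powr p * (real (L * L) * \<omega> i))"
      by (rule prod_ennreal) (intro mult_nonneg_nonneg nn powr_ge_zero)
    finally show ?thesis
      by (simp only: ennreal_mult'[OF powr_ge_zero])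
  qed
  finally have "s powr p * (\<Prod>i\<in>{1..m}. \<kappa>_trunc L i powr p * (real (L * L) * \<omega> i)) \<le> op powr p"
    by (subst (asm) ennreal_le_iff) auto
  moreover define A where "A = (\<Prod>i\<in>{1..m}. \<kappa>_trunc L i)"
  moreover define W where "W = (\<Prod>i\<in>{1..m}. \<omega> i)"
  ultimately have main: "s powr p * (A powr p * (real (L * L) ^ m * W)) \<le> op powr p"
    by (simp add: prod.distrib prod_powr_distrib)
  have A0: "0 \<le> A" unfolding A_def by (intro prod_nonneg) auto
  have VW: "V = real (L * L) ^ m * W * (1 + 2 / real L) ^ m"
  proof -
    have "real (L * L + 2 * L) = real (L * L) * (1 + 2 / real L)" using L by (simp add: field_simps)
    then show ?thesis by (simp add: V_def W_def prod.distrib power_mult_distrib)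
  qed
  have "A powr p \<le> op powr p * (1 + 2 / real L) ^ m"
  proof -
    have "A powr p = (s powr p * V) * A powr p" by (simp add: s)
    also have "\<dots> = s powr p * (A powr p * (real (L * L) ^ m * W)) * (1 + 2 / real L) ^ m"
      by (simp only: VW ac_simps)
    also have "\<dots> \<le> op powr p * (1 + 2 / real L) ^ m"
      using main by (rule mult_right_mono) simp
    finally show ?thesis .
  qed
  then have "(A powr p) powr (1 / p) \<le> (op powr p * (1 + 2 / real L) ^ m) powr (1 / p)"
    using p by (intro powr_mono2) auto
  then show ?thesis
    using p A0 op by (simp add: powr_powr powr_mult A_def)
qed

text \<open>
  The truncated constants converge to $C$ and the correction factors to $1$ as $L$ tends to infinity.
\<close>

lemma opnorm_eq:
  "Lp_opnorm p (leb m n) (T_op m n K :: ((nat \<Rightarrow> nat \<Rightarrow> real) \<Rightarrow> 'b::{real_normed_field, banach, second_countable_topology}) \<Rightarrow> _)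
    = ennreal C" (is "?op = _")
proof (rule antisym[OF opnorm_le])
  define r where "r = enn2real ?op"
  have r: "?op = ennreal r" "0 \<le> r"
    using le_less_trans[OF opnorm_le[where 'b = 'b] ennreal_less_top] by (auto simp: r_def)
  have "C \<le> r * 1"
  proof (rule LIMSEQ_le)
    show "(\<lambda>L. \<Prod>i\<in>{1..m}. \<kappa>_trunc L i) \<longlonglongrightarrow> C"
      by (intro tendsto_prod \<kappa>_trunc_tendsto)
    have "(\<lambda>L. 2 / real L) \<longlonglongrightarrow> 0" by (rule lim_const_over_n)
    then have "(\<lambda>L. r * ((1 + 2 / real L) ^ m) powr (1 / p)) \<longlonglongrightarrow> r * ((1 + 0) ^ m) powr (1 / p)"
      by (intro tendsto_intros) auto
    then show "(\<lambda>L. r * ((1 + 2 / real L) ^ m) powr (1 / p)) \<longlonglongrightarrow> r * 1" by simp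
    show "\<exists>N. \<forall>L\<ge>N. (\<Prod>i\<in>{1..m}. \<kappa>_trunc L i) \<le> r * ((1 + 2 / real L) ^ m) powr (1 / p)"
      using opnorm_ge_truncated[OF _ r(2) eq_refl[OF r(1)]] by blast
  qed
  then show "ennreal C \<le> ?op" by (simp add: r ennreal_leI)
qed

end

theorem theorem1:
  fixes p :: real and m :: nat and n :: "nat \<Rightarrow> nat"
    and K :: "nat \<Rightarrow> (nat \<Rightarrow> real) \<Rightarrow> (nat \<Rightarrow> real) \<Rightarrow> real"
  assumes p: "1 < p"
    and m: "1 \<le> m"
    and n: "\<And>i. i \<in> {1..m} \<Longrightarrow> 1 \<le> n i"
    and nonneg: "\<And>d u v. d \<in> n ` {1..m} \<Longrightarrow> u \<in> Rn d \<Longrightarrow> v \<in> Rn d \<Longrightarrow> 0 \<le> K d u v"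
    and cont: "\<And>d. d \<in> n ` {1..m} \<Longrightarrow>
      continuous_on (Rn d \<times> Rn d - {(origin d, origin d)}) (\<lambda>(u, v). K d u v)"
    and homogeneous: "\<And>d u v \<delta>. d \<in> n ` {1..m} \<Longrightarrow> u \<in> Rn d \<Longrightarrow> v \<in> Rn d \<Longrightarrow> 0 < \<delta> \<Longrightarrow>
      K d (dilate d \<delta> u) (dilate d \<delta> v) = \<delta> powr (- real d) * K d u v"
    and rotation: "\<And>d u v R. d \<in> n ` {1..m} \<Longrightarrow> u \<in> Rn d \<Longrightarrow> v \<in> Rn d \<Longrightarrow> R \<in> SO d \<Longrightarrow>
      K d (mat_apply d R u) (mat_apply d R v) = K d u v"
    \<comment> \<open>SO 1 is trivial and does not act transitively on the unit sphere \<open>{1, -1}\<close>; without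
      invariance under the reflection the conclusion fails in dimension one, for instance for
      K(u,v) = (|u| - u) / (u^2 + v^2).\<close>
    and reflection: "\<And>u v. 1 \<in> n ` {1..m} \<Longrightarrow> u \<in> Rn 1 \<Longrightarrow> v \<in> Rn 1 \<Longrightarrow>
      K 1 (dilate 1 (- 1) u) (dilate 1 (- 1) v) = K 1 u v"
  shows
    "C_const p m n K < \<infinity> \<and>
     (\<forall>f \<in> Lp p (leb m n) ::
          ((nat \<Rightarrow> nat \<Rightarrow> real) \<Rightarrow> 'b::{real_normed_field, banach, second_countable_topology}) set.
        (AE x in leb m n. integrable (leb m n) (\<lambda>y. prod_kernel m n K x y *\<^sub>R f y)) \<and>
        T_op m n K f \<in> Lp p (leb m n) \<and>
        Lp_norm p (leb m n) (T_op m n K f) \<le> C_const p m n K * Lp_norm p (leb m n) f) \<and>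
     Lp_opnorm p (leb m n)
       (T_op m n K :: ((nat \<Rightarrow> nat \<Rightarrow> real) \<Rightarrow> 'b) \<Rightarrow> (nat \<Rightarrow> nat \<Rightarrow> real) \<Rightarrow> 'b) = C_const p m n K"
proof -
  interpret kernel_family p m n K
  proof (rule kernel_family.intro[OF p])
    fix i assume i: "i \<in> {1..m}"
    then have d: "n i \<in> n ` {1..m}" by blast
    show "homogeneous_kernel (n i) (K (n i))"
    proof (rule homogeneous_kernel.intro)
      show "K (n i) (dilate 1 (- 1) u) (dilate 1 (- 1) v) = K (n i) u v"
        if "n i = 1" "u \<in> Rn 1" "v \<in> Rn 1" for u v
        using reflection[OF d[unfolded that(1)] that(2,3)] by (simp only: that(1))
    qed (use n[OF i] nonneg[OF d] cont[OF d] homogeneous[OF d] rotation[OF d] in auto)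
  qed
  show ?thesis
    unfolding C_const_eq
  proof (intro conjI ballI)
    show "ennreal C < \<infinity>" by simp
    fix f :: "(nat \<Rightarrow> nat \<Rightarrow> real) \<Rightarrow> 'b" assume f: "f \<in> Lp p (leb m n)"
    show "AE x in leb m n. integrable (leb m n) (\<lambda>y. k x y *\<^sub>R f y)" by (rule T_op_bound(1)[OF f])
    show "T_op m n K f \<in> Lp p (leb m n)" by (rule T_op_Lp(1)[OF f])
    show "Lp_norm p (leb m n) (T_op m n K f) \<le> ennreal C * Lp_norm p (leb m n) f"
      by (rule T_op_Lp(2)[OF f])
  qed (rule opnorm_eq)
qed

end
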